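(* Let $U_1,\dots,U_r$, $V_1,\dots,V_s$ be nontrivial irreducible $\mathfrak{g}$-modules and let $z_1,\dots,z_r$ and $\xi_1,\dots,\xi_s$ be two groups of distinct nonzero complex numbers (i.e. the $z_j$ are pairwise distinct and the $\xi_j$ are pairwise distinct). Then the $\hat{\mathfrak{g}}[\sigma]$-module $U_1(z_1)\otimes\cdots\otimes U_r(z_r)$ is isomorphic to $V_1(\xi_1)\otimes\cdots\otimes V_s(\xi_s)$ if and only if $r=s$ and, up to a permutation, $z_j=\xi_j$ and $U_j\cong V_j$ for all $j$.
   Context: Let $\mathfrak{g}$ be a finite-dimensional simple Lie algebra over $\mathbb{C}$ with the nondegenerate symmetric invariant bilinear form $\langle\cdot,\cdot\rangle$ normalized so that the squared length of the longest roots is $2$. Let $\sigma$ be an automorphism of $\mathfrak{g}$ of order $N$, $\varepsilon=\exp(2\pi \sqrt{-1}/N)$, and $\mathfrak{g}_i=\{a\in\mathfrak{g}\mid \sigma(a)=\varepsilon^i a\}$ for $0\le i\le N-1$, so $\mathfrak{g}=\bigoplus_{i=0}^{N-1}\mathfrak{g}_i$. The twisted affine Lie algebra is $\hat{\mathfrak{g}}[\sigma]=\bigoplus_{i=0}^{N-1}\mathfrak{g}_i\otimes t^{i/N}\mathbb{C}[t,t^{-1}]\oplus\mathbb{C}\mathbf{k}$ with $\mathbf{k}$ a nonzero central element and $[a\otimes t^{m+i/N},b\otimes t^{n+j/N}]=[a,b]\otimes t^{m+n+(i+j)/N}+(m+\tfrac{i}{N})\langle a,b\rangle\delta_{m+i/N,\,-n-j/N}\mathbf{k}$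 for $a\in\mathfrak{g}_i$, $b\in\mathfrak{g}_j$, $m,n\in\mathbb{Z}$. Evaluation modules: for each nonzero complex number $z$ fix, once and for all, an $N$-th root $z^{1/N}$. For a $\mathfrak{g}$-module $U$, $U(z)$ is the space $U$ with the $\hat{\mathfrak{g}}[\sigma]$-action $(a\otimes t^{n+i/N})u=z^{n+i/N}(au)$ for $a\in\mathfrak{g}_i$, $n\in\mathbb{Z}$, $u\in U$ (where $z^{n+i/N}=z^n(z^{1/N})^i$), and $\mathbf{k}U=0$. A module of $\mathfrak g$ is nontrivial if $\mathfrak{g}$ does not act on it as zero. *)

theory Defs
  imports
    Complex_Main
    "HOL-Library.FuncSet"
    "HOL-Combinatorics.Permutations"
    "HOL-Algebra.AbelCoset"
    "HOL-Algebra.Module"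
    "HOL-Algebra.Algebraic_Closure_Type"
begin

section \<open>Complex vector spaces, Lie algebras and their modules\<close>

text \<open>Complex vector spaces are \<open>module\<close> records of HOL-Algebra over the ring of complex
  numbers. The fields \<open>mult\<close> and \<open>one\<close>, which that record inherits from rings, play no role.\<close>

abbreviation complex_ring :: "complex ring" where
  "complex_ring \<equiv> ring_of_type_algebra"

definition vspan :: "(complex, 'a, 'm) module_scheme \<Rightarrow> 'a set \<Rightarrow> 'a set" where
  "vspan V S = \<Inter> {H. submodule H complex_ring V \<and> S \<subseteq> H}"

definition finite_dimensional :: "(complex, 'a, 'm) module_scheme \<Rightarrow> bool" where
  "finite_dimensional V \<longleftrightarrow> (\<exists>S. finite S \<and> S \<subseteq> carrier V \<and> vspan V S = carrier V)"

definition linear_form :: "(complex, 'a, 'm) module_scheme \<Rightarrow> 'a set \<Rightarrow> ('a \<Rightarrow> complex) \<Rightarrow> bool" where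
  "linear_form V W f \<longleftrightarrow>
     (\<forall>x\<in>W. \<forall>y\<in>W. f (x \<oplus>\<^bsub>V\<^esub> y) = f x + f y) \<and> (\<forall>c. \<forall>x\<in>W. f (c \<odot>\<^bsub>V\<^esub> x) = c * f x)"

record 'g lie_algebra = "(complex, 'g) module" +
  bracket :: "'g \<Rightarrow> 'g \<Rightarrow> 'g"

locale lie_algebra = module complex_ring L
  for L :: "('g, 'm) lie_algebra_scheme" (structure) +
  assumes bracket_closed:
      "\<lbrakk>x \<in> carrier L; y \<in> carrier L\<rbrakk> \<Longrightarrow> bracket L x y \<in> carrier L"
    and bracket_add_left:
      "\<lbrakk>x \<in> carrier L; y \<in> carrier L; w \<in> carrier L\<rbrakk> \<Longrightarrow>
        bracket L (x \<oplus> y) w = bracket L x w \<oplus> bracket L y w"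
    and bracket_add_right:
      "\<lbrakk>x \<in> carrier L; y \<in> carrier L; w \<in> carrier L\<rbrakk> \<Longrightarrow>
        bracket L x (y \<oplus> w) = bracket L x y \<oplus> bracket L x w"
    and bracket_smult_left:
      "\<lbrakk>x \<in> carrier L; y \<in> carrier L\<rbrakk> \<Longrightarrow> bracket L (c \<odot> x) y = c \<odot> bracket L x y"
    and bracket_smult_right:
      "\<lbrakk>x \<in> carrier L; y \<in> carrier L\<rbrakk> \<Longrightarrow> bracket L x (c \<odot> y) = c \<odot> bracket L x y"
    and bracket_self: "x \<in> carrier L \<Longrightarrow> bracket L x x = \<zero>"
    and jacobi:
      "\<lbrakk>x \<in> carrier L; y \<in> carrier L; w \<in> carrier L\<rbrakk> \<Longrightarrow>
        bracket L x (bracket L y w) \<oplus> bracket L y (bracket L w x) \<oplus> bracket L w (bracket L x y) = \<zero>"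

definition lie_ideal :: "('g, 'm) lie_algebra_scheme \<Rightarrow> 'g set \<Rightarrow> bool" where
  "lie_ideal L J \<longleftrightarrow> submodule J complex_ring L \<and> (\<forall>x\<in>carrier L. \<forall>y\<in>J. bracket L x y \<in> J)"

definition simple_lie_algebra :: "('g, 'm) lie_algebra_scheme \<Rightarrow> bool" where
  "simple_lie_algebra L \<longleftrightarrow> lie_algebra L \<and>
     (\<exists>x\<in>carrier L. \<exists>y\<in>carrier L. bracket L x y \<noteq> \<zero>\<^bsub>L\<^esub>) \<and>
     (\<forall>J. lie_ideal L J \<longrightarrow> J = {\<zero>\<^bsub>L\<^esub>} \<or> J = carrier L)"

record ('g, 'u) lie_module = "(complex, 'u) module" +
  act :: "'g \<Rightarrow> 'u \<Rightarrow> 'u"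

locale lie_module = L?: lie_algebra L + M?: module complex_ring M
  for L :: "('g, 'l) lie_algebra_scheme" (structure)
    and M :: "('g, 'u, 'm) lie_module_scheme" (structure) +
  assumes act_closed:
      "\<lbrakk>x \<in> carrier L; u \<in> carrier M\<rbrakk> \<Longrightarrow> act M x u \<in> carrier M"
    and act_add_left:
      "\<lbrakk>x \<in> carrier L; y \<in> carrier L; u \<in> carrier M\<rbrakk> \<Longrightarrow>
        act M (x \<oplus>\<^bsub>L\<^esub> y) u = act M x u \<oplus>\<^bsub>M\<^esub> act M y u"
    and act_add_right:
      "\<lbrakk>x \<in> carrier L; u \<in> carrier M; v \<in> carrier M\<rbrakk> \<Longrightarrow>
        act M x (u \<oplus>\<^bsub>M\<^esub> v) = act M x u \<oplus>\<^bsub>M\<^esub> act M x v"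
    and act_smult_left:
      "\<lbrakk>x \<in> carrier L; u \<in> carrier M\<rbrakk> \<Longrightarrow> act M (c \<odot>\<^bsub>L\<^esub> x) u = c \<odot>\<^bsub>M\<^esub> act M x u"
    and act_smult_right:
      "\<lbrakk>x \<in> carrier L; u \<in> carrier M\<rbrakk> \<Longrightarrow> act M x (c \<odot>\<^bsub>M\<^esub> u) = c \<odot>\<^bsub>M\<^esub> act M x u"
    and act_bracket:
      "\<lbrakk>x \<in> carrier L; y \<in> carrier L; u \<in> carrier M\<rbrakk> \<Longrightarrow>
        act M (bracket L x y) u = act M x (act M y u) \<ominus>\<^bsub>M\<^esub> act M y (act M x u)"

definition irreducible_lie_module ::
    "('g, 'l) lie_algebra_scheme \<Rightarrow> ('g, 'u, 'm) lie_module_scheme \<Rightarrow> bool" where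
  "irreducible_lie_module L M \<longleftrightarrow> lie_module L M \<and> carrier M \<noteq> {\<zero>\<^bsub>M\<^esub>} \<and>
     (\<forall>W. submodule W complex_ring M \<and> (\<forall>x\<in>carrier L. \<forall>w\<in>W. act M x w \<in> W) \<longrightarrow>
        W = {\<zero>\<^bsub>M\<^esub>} \<or> W = carrier M)"

definition nontrivial_lie_module ::
    "('g, 'l) lie_algebra_scheme \<Rightarrow> ('g, 'u, 'm) lie_module_scheme \<Rightarrow> bool" where
  "nontrivial_lie_module L M \<longleftrightarrow> (\<exists>x\<in>carrier L. \<exists>u\<in>carrier M. act M x u \<noteq> \<zero>\<^bsub>M\<^esub>)"

definition lie_module_isomorphic ::
    "('g, 'l) lie_algebra_scheme \<Rightarrow> ('g, 'u, 'm) lie_module_scheme \<Rightarrow>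
     ('g, 'v, 'n) lie_module_scheme \<Rightarrow> bool" where
  "lie_module_isomorphic L M M' \<longleftrightarrow>
     (\<exists>\<phi>. bij_betw \<phi> (carrier M) (carrier M') \<and>
       (\<forall>u\<in>carrier M. \<forall>v\<in>carrier M. \<phi> (u \<oplus>\<^bsub>M\<^esub> v) = \<phi> u \<oplus>\<^bsub>M'\<^esub> \<phi> v) \<and>
       (\<forall>c. \<forall>u\<in>carrier M. \<phi> (c \<odot>\<^bsub>M\<^esub> u) = c \<odot>\<^bsub>M'\<^esub> \<phi> u) \<and>
       (\<forall>x\<in>carrier L. \<forall>u\<in>carrier M. \<phi> (act M x u) = act M' x (\<phi> u)))"


section \<open>The normalized invariant form\<close>

primrec lower_central :: "('g, 'm) lie_algebra_scheme \<Rightarrow> 'g set \<Rightarrow> nat \<Rightarrow> 'g set" where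
  "lower_central L H 0 = H"
| "lower_central L H (Suc n) = vspan L {bracket L h x |h x. h \<in> H \<and> x \<in> lower_central L H n}"

text \<open>A Cartan subalgebra is a nilpotent subalgebra that equals its own normalizer.\<close>

definition cartan_subalgebra :: "('g, 'm) lie_algebra_scheme \<Rightarrow> 'g set \<Rightarrow> bool" where
  "cartan_subalgebra L H \<longleftrightarrow> submodule H complex_ring L \<and>
     (\<forall>x\<in>H. \<forall>y\<in>H. bracket L x y \<in> H) \<and>
     (\<exists>n. lower_central L H n = {\<zero>\<^bsub>L\<^esub>}) \<and>
     {x \<in> carrier L. \<forall>h\<in>H. bracket L x h \<in> H} = H"

definition roots :: "('g, 'm) lie_algebra_scheme \<Rightarrow> 'g set \<Rightarrow> ('g \<Rightarrow> complex) set" where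
  "roots L H = {\<alpha> \<in> extensional H. linear_form L H \<alpha> \<and> (\<exists>h\<in>H. \<alpha> h \<noteq> 0) \<and>
     (\<exists>x\<in>carrier L. x \<noteq> \<zero>\<^bsub>L\<^esub> \<and> (\<forall>h\<in>H. bracket L h x = \<alpha> h \<odot>\<^bsub>L\<^esub> x))}"

text \<open>The form on the dual of \<open>H\<close> is transported along the isomorphism \<open>t \<mapsto> B t\<close>
  from \<open>H\<close> to its dual.\<close>

definition square_length :: "('g \<Rightarrow> 'g \<Rightarrow> complex) \<Rightarrow> 'g set \<Rightarrow> ('g \<Rightarrow> complex) \<Rightarrow> complex" where
  "square_length B H \<alpha> = (let t = (THE t. t \<in> H \<and> (\<forall>h\<in>H. B t h = \<alpha> h)) in B t t)"

text \<open>All Cartan subalgebras are conjugate, so the last condition does not depend on the choice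
  of \<open>H\<close>.\<close>

definition normalized_invariant_form ::
    "('g, 'm) lie_algebra_scheme \<Rightarrow> ('g \<Rightarrow> 'g \<Rightarrow> complex) \<Rightarrow> bool" where
  "normalized_invariant_form L B \<longleftrightarrow>
     (\<forall>x\<in>carrier L. linear_form L (carrier L) (B x)) \<and>
     (\<forall>y\<in>carrier L. linear_form L (carrier L) (\<lambda>x. B x y)) \<and>
     (\<forall>x\<in>carrier L. \<forall>y\<in>carrier L. B x y = B y x) \<and>
     (\<forall>x\<in>carrier L. \<forall>y\<in>carrier L. \<forall>w\<in>carrier L. B (bracket L x y) w = B x (bracket L y w)) \<and>
     (\<forall>x\<in>carrier L. (\<forall>y\<in>carrier L. B x y = 0) \<longrightarrow> x = \<zero>\<^bsub>L\<^esub>) \<and>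
     (\<exists>H. cartan_subalgebra L H \<and>
        (\<exists>\<alpha>\<in>roots L H. square_length B H \<alpha> = 2) \<and>
        (\<forall>\<alpha>\<in>roots L H. square_length B H \<alpha> \<in> \<real> \<and> Re (square_length B H \<alpha>) \<le> 2))"


section \<open>Twisted affine Lie algebras\<close>

definition lie_automorphism :: "('g, 'm) lie_algebra_scheme \<Rightarrow> ('g \<Rightarrow> 'g) \<Rightarrow> bool" where
  "lie_automorphism L \<sigma> \<longleftrightarrow> bij_betw \<sigma> (carrier L) (carrier L) \<and>
     (\<forall>x\<in>carrier L. \<forall>y\<in>carrier L. \<sigma> (x \<oplus>\<^bsub>L\<^esub> y) = \<sigma> x \<oplus>\<^bsub>L\<^esub> \<sigma> y) \<and>
     (\<forall>c. \<forall>x\<in>carrier L. \<sigma> (c \<odot>\<^bsub>L\<^esub> x) = c \<odot>\<^bsub>L\<^esub> \<sigma> x) \<and>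
     (\<forall>x\<in>carrier L. \<forall>y\<in>carrier L. \<sigma> (bracket L x y) = bracket L (\<sigma> x) (\<sigma> y))"

definition has_order :: "('g, 'm) lie_algebra_scheme \<Rightarrow> ('g \<Rightarrow> 'g) \<Rightarrow> nat \<Rightarrow> bool" where
  "has_order L \<sigma> N \<longleftrightarrow> N > 0 \<and> (\<forall>x\<in>carrier L. (\<sigma> ^^ N) x = x) \<and>
     (\<forall>k. 0 < k \<and> k < N \<longrightarrow> (\<exists>x\<in>carrier L. (\<sigma> ^^ k) x \<noteq> x))"

definition graded_part ::
    "('g, 'm) lie_algebra_scheme \<Rightarrow> ('g \<Rightarrow> 'g) \<Rightarrow> nat \<Rightarrow> nat \<Rightarrow> 'g set" where
  "graded_part L \<sigma> N i =
     {a \<in> carrier L. \<sigma> a = (exp (2 * of_real pi * \<i> / of_nat N) ^ i) \<odot>\<^bsub>L\<^esub> a}"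

text \<open>An element of the twisted affine algebra is a pair \<open>(f, c)\<close>: \<open>f p\<close> is the coefficient of
  \<open>t\<close> to the power \<open>p / N\<close>, where \<open>p = m N + i\<close> with \<open>0 \<le> i < N\<close> corresponds to the exponent
  \<open>m + i / N\<close>, and \<open>c\<close> is the coefficient of the central element.\<close>

definition twisted_affine ::
    "('g, 'm) lie_algebra_scheme \<Rightarrow> ('g \<Rightarrow> 'g \<Rightarrow> complex) \<Rightarrow> ('g \<Rightarrow> 'g) \<Rightarrow> nat \<Rightarrow>
     ((int \<Rightarrow> 'g) \<times> complex) lie_algebra" where
  "twisted_affine L B \<sigma> N =
     \<lparr>carrier = {(f, c). finite {p. f p \<noteq> \<zero>\<^bsub>L\<^esub>} \<and>
                         (\<forall>p. f p \<in> graded_part L \<sigma> N (nat (p mod int N)))},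
      monoid.mult = undefined, one = undefined,
      zero = (\<lambda>_. \<zero>\<^bsub>L\<^esub>, 0),
      add = (\<lambda>(f, c) (g, d). (\<lambda>p. f p \<oplus>\<^bsub>L\<^esub> g p, c + d)),
      module.smult = (\<lambda>b (f, c). (\<lambda>p. b \<odot>\<^bsub>L\<^esub> f p, b * c)),
      bracket = (\<lambda>(f, c) (g, d).
        (\<lambda>n. \<Oplus>\<^bsub>L\<^esub>p\<in>{p. f p \<noteq> \<zero>\<^bsub>L\<^esub>}. bracket L (f p) (g (n - p)),
         \<Sum>p\<in>{p. f p \<noteq> \<zero>\<^bsub>L\<^esub>}. (of_int p / of_nat N) * B (f p) (g (- p))))\<rparr>"

definition loop_monom :: "('g, 'm) lie_algebra_scheme \<Rightarrow> 'g \<Rightarrow> int \<Rightarrow> (int \<Rightarrow> 'g) \<times> complex" where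
  "loop_monom L a p = (\<lambda>q. if q = p then a else \<zero>\<^bsub>L\<^esub>, 0)"

lemma bracket_loop_monom:
  fixes L :: "('g, 'm) lie_algebra_scheme" and m n :: int and i j N :: nat
  assumes L: "lie_algebra L" and B: "normalized_invariant_form L B" and N: "N > 0"
    and a: "a \<in> graded_part L \<sigma> N i" and b: "b \<in> graded_part L \<sigma> N j"
  shows "bracket (twisted_affine L B \<sigma> N)
           (loop_monom L a (m * int N + int i)) (loop_monom L b (n * int N + int j)) =
         loop_monom L (bracket L a b) ((m + n) * int N + int (i + j))
         \<oplus>\<^bsub>twisted_affine L B \<sigma> N\<^esub>
         (\<lambda>_. \<zero>\<^bsub>L\<^esub>, (of_int m + of_nat i / of_nat N) * B a b *
           (if of_int m + of_nat i / of_nat N = - of_int n - (of_nat j / of_nat N :: complex)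
            then 1 else 0))"
proof -
  interpret lie_algebra L by fact
  have aL: "a \<in> carrier L" and bL: "b \<in> carrier L"
    using a b by (auto simp: graded_part_def)
  define p where "p = m * int N + int i"
  define q where "q = n * int N + int j"
  have S: "{k. (if k = p then a else \<zero>\<^bsub>L\<^esub>) \<noteq> \<zero>\<^bsub>L\<^esub>} = (if a = \<zero>\<^bsub>L\<^esub> then {} else {p})"
    by auto
  have zl: "bracket L \<zero>\<^bsub>L\<^esub> y = \<zero>\<^bsub>L\<^esub>" if "y \<in> carrier L" for y
    using bracket_smult_left[of "\<zero>\<^bsub>L\<^esub>" y "0"] smult_l_null[of "\<zero>\<^bsub>L\<^esub>"] smult_l_null[of "bracket L \<zero>\<^bsub>L\<^esub> y"]
      bracket_closed[of "\<zero>\<^bsub>L\<^esub>" y] that by (simp add: ring_of_type_algebra_def)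
  have zr: "bracket L x \<zero>\<^bsub>L\<^esub> = \<zero>\<^bsub>L\<^esub>" if "x \<in> carrier L" for x
    using bracket_smult_right[of x "\<zero>\<^bsub>L\<^esub>" "0"] smult_l_null[of "\<zero>\<^bsub>L\<^esub>"] smult_l_null[of "bracket L x \<zero>\<^bsub>L\<^esub>"]
      bracket_closed[of x "\<zero>\<^bsub>L\<^esub>"] that by (simp add: ring_of_type_algebra_def)
  have zB: "B \<zero>\<^bsub>L\<^esub> y = 0" if "y \<in> carrier L" for y
  proof -
    have "B (\<zero>\<^bsub>L\<^esub> \<oplus>\<^bsub>L\<^esub> \<zero>\<^bsub>L\<^esub>) y = B \<zero>\<^bsub>L\<^esub> y + B \<zero>\<^bsub>L\<^esub> y"
      using B that unfolding normalized_invariant_form_def linear_form_def by blast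
    then show ?thesis by simp
  qed
  have zB2: "B y \<zero>\<^bsub>L\<^esub> = 0" if "y \<in> carrier L" for y
  proof -
    have "B y \<zero>\<^bsub>L\<^esub> = B \<zero>\<^bsub>L\<^esub> y"
      using B that unfolding normalized_invariant_form_def by blast
    then show ?thesis using zB[OF that] by simp
  qed
  have pq: "(m + n) * int N + int (i + j) = p + q"
    by (simp add: p_def q_def algebra_simps)
  have dp: "of_int m + of_nat i / of_nat N = (of_int p / of_nat N :: complex)"
    using N by (simp add: p_def add_divide_distrib)
  have "- of_int n - of_nat j / of_nat N = (of_int (- q) / of_nat N :: complex)"
    using N by (simp add: q_def add_divide_distrib diff_divide_distrib minus_divide_left)
  then have d: "of_int m + of_nat i / of_nat N = - of_int n - (of_nat j / of_nat N :: complex)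
      \<longleftrightarrow> p = - q"
    unfolding dp using N by (simp add: divide_cancel_right del: of_int_minus)
  have ab: "bracket L a b \<in> carrier L" using bracket_closed[OF aL bL] .
  have br: "bracket (twisted_affine L B \<sigma> N) (loop_monom L a p) (loop_monom L b q) =
      (\<lambda>k. if k = p + q then bracket L a b else \<zero>\<^bsub>L\<^esub>,
       of_int p / of_nat N * B a b * (if p = - q then 1 else 0))"
  proof (cases "a = \<zero>\<^bsub>L\<^esub>")
    case True
    then show ?thesis
      using zl[OF bL] zB[OF bL] by (simp add: twisted_affine_def loop_monom_def fun_eq_iff)
  next
    case False
    have "finsum L (\<lambda>k. bracket L (if k = p then a else \<zero>\<^bsub>L\<^esub>) (if l - k = q then b else \<zero>\<^bsub>L\<^esub>)) {p}
        = (if l = p + q then bracket L a b else \<zero>\<^bsub>L\<^esub>)" for l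
      using aL bL ab zr[OF aL] by auto
    then show ?thesis
      using False zB2[OF aL] by (simp add: twisted_affine_def loop_monom_def S minus_equation_iff)
  qed
  show ?thesis
    unfolding d unfolding dp pq p_def[symmetric] q_def[symmetric] br
    using ab by (simp add: twisted_affine_def loop_monom_def fun_eq_iff)
qed


section \<open>Evaluation modules\<close>

text \<open>\<open>rt\<close> is the chosen branch of the \<open>N\<close>-th root; the central element acts as zero.\<close>

definition eval_module ::
    "nat \<Rightarrow> (complex \<Rightarrow> complex) \<Rightarrow> ('g, 'm) lie_algebra_scheme \<Rightarrow> ('g, 'u) lie_module \<Rightarrow> complex \<Rightarrow>
     ((int \<Rightarrow> 'g) \<times> complex, 'u) lie_module" where
  "eval_module N rt L M z =
     \<lparr>carrier = carrier M, monoid.mult = monoid.mult M, one = one M,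
      zero = zero M, add = add M, module.smult = module.smult M,
      act = (\<lambda>(f, c) u. \<Oplus>\<^bsub>M\<^esub>p\<in>{p. f p \<noteq> \<zero>\<^bsub>L\<^esub>}.
        (z powi (p div int N) * rt z ^ nat (p mod int N)) \<odot>\<^bsub>M\<^esub> act M (f p) u)\<rparr>"


lemma act_eval_loop_monom:
  fixes L :: "('g, 'm) lie_algebra_scheme" and M :: "('g, 'u) lie_module"
    and n :: int and i N :: nat
  assumes M: "lie_module L M" and i: "i < N"
    and a: "a \<in> graded_part L \<sigma> N i" and u: "u \<in> carrier M"
  shows "act (eval_module N rt L M z) (loop_monom L a (n * int N + int i)) u =
         (z powi n * rt z ^ i) \<odot>\<^bsub>M\<^esub> act M a u"
proof -
  interpret lie_module L M by fact
  have aL: "a \<in> carrier L" using a by (simp add: graded_part_def)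
  have au: "act M a u \<in> carrier M" using act_closed[OF aL u] .
  have sc: "c \<odot>\<^bsub>M\<^esub> act M a u \<in> carrier M" for c
    using M.smult_closed[OF _ au, of c] by (simp add: ring_of_type_algebra_def)
  define p where "p = n * int N + int i"
  have p: "p div int N = n" "nat (p mod int N) = i"
    using i by (simp_all add: p_def)
  show ?thesis
  proof (cases "a = \<zero>\<^bsub>L\<^esub>")
    case True
    have "act M (0 \<odot>\<^bsub>L\<^esub> a) u = 0 \<odot>\<^bsub>M\<^esub> act M a u"
      by (rule act_smult_left[OF aL u])
    then have "act M a u = \<zero>\<^bsub>M\<^esub>"
      using L.smult_l_null[OF aL] M.smult_l_null[OF au] True by (simp add: ring_of_type_algebra_def)
    then show ?thesis
      using True M.smult_r_null by (simp add: eval_module_def loop_monom_def ring_of_type_algebra_def)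
  next
    case False
    then have "{k. (if k = p then a else \<zero>\<^bsub>L\<^esub>) \<noteq> \<zero>\<^bsub>L\<^esub>} = {p}" by auto
    then show ?thesis
      using sc p by (simp add: eval_module_def loop_monom_def p_def[symmetric])
  qed
qed


section \<open>Tensor products of modules\<close>

text \<open>The tensor product of a finite family of spaces is the free vector space on the product of
  their carriers modulo the relations of multilinearity. The vectors of the free space are the
  finitely supported functions on the product.\<close>

definition basis_vec :: "'b \<Rightarrow> 'b \<Rightarrow> complex" where
  "basis_vec u = (\<lambda>v. if v = u then 1 else 0)"

definition free_module ::
    "'i set \<Rightarrow> ('i \<Rightarrow> ('g, 'u) lie_module) \<Rightarrow> ('g, ('i \<Rightarrow> 'u) \<Rightarrow> complex) lie_module" where
  "free_module I M =
     \<lparr>carrier = {f. finite {u. f u \<noteq> 0} \<and> {u. f u \<noteq> 0} \<subseteq> (\<Pi>\<^sub>E i\<in>I. carrier (M i))},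
      monoid.mult = undefined, one = undefined,
      zero = (\<lambda>_. 0),
      add = (\<lambda>f g v. f v + g v),
      module.smult = (\<lambda>c f v. c * f v),
      act = (\<lambda>x f v. \<Sum>u\<in>{u. f u \<noteq> 0}. f u * (\<Sum>i\<in>I. basis_vec (u(i := act (M i) x (u i))) v))\<rparr>"

lemma act_basis_vec:
  "act (free_module I M) x (basis_vec u) = (\<lambda>v. \<Sum>i\<in>I. basis_vec (u(i := act (M i) x (u i))) v)"
proof -
  have "{w. basis_vec u w \<noteq> 0} = {u}" by (auto simp: basis_vec_def)
  moreover have "basis_vec u u = 1" by (simp add: basis_vec_def)
  ultimately show ?thesis by (simp add: free_module_def)
qed

definition multilinear_relations ::
    "'i set \<Rightarrow> ('i \<Rightarrow> ('g, 'u) lie_module) \<Rightarrow> (('i \<Rightarrow> 'u) \<Rightarrow> complex) set" where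
  "multilinear_relations I M =
     {(\<lambda>v. basis_vec (u(i := x \<oplus>\<^bsub>M i\<^esub> y)) v - basis_vec (u(i := x)) v - basis_vec (u(i := y)) v)
        |u i x y. u \<in> (\<Pi>\<^sub>E i\<in>I. carrier (M i)) \<and> i \<in> I \<and> x \<in> carrier (M i) \<and> y \<in> carrier (M i)} \<union>
     {(\<lambda>v. basis_vec (u(i := c \<odot>\<^bsub>M i\<^esub> x)) v - c * basis_vec (u(i := x)) v)
        |u i c x. u \<in> (\<Pi>\<^sub>E i\<in>I. carrier (M i)) \<and> i \<in> I \<and> x \<in> carrier (M i)}"

definition quotient_module ::
    "('g, 'u) lie_module \<Rightarrow> 'u set \<Rightarrow> ('g, 'u set) lie_module" where
  "quotient_module M W =
     \<lparr>carrier = a_rcosets\<^bsub>M\<^esub> W,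
      monoid.mult = undefined, one = undefined,
      zero = W,
      add = (\<lambda>C D. C <+>\<^bsub>M\<^esub> D),
      module.smult = (\<lambda>c C. \<Union>u\<in>C. W +>\<^bsub>M\<^esub> (c \<odot>\<^bsub>M\<^esub> u)),
      act = (\<lambda>x C. \<Union>u\<in>C. W +>\<^bsub>M\<^esub> act M x u)\<rparr>"

definition tensor_module ::
    "'i set \<Rightarrow> ('i \<Rightarrow> ('g, 'u) lie_module) \<Rightarrow> ('g, (('i \<Rightarrow> 'u) \<Rightarrow> complex) set) lie_module" where
  "tensor_module I M =
     quotient_module (free_module I M) (vspan (free_module I M) (multilinear_relations I M))"

end

theory Submission
  imports Defs
begin

text \<open>For every point \<open>w\<close> and every \<open>a \<in> L\<close> polynomial interpolation gives an element of the twisted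
  affine algebra that acts on \<open>U(z)\<close> as \<open>a\<close> if \<open>z = w\<close> and as zero if \<open>z\<close> is any other of the given
  points. Hence an isomorphism \<open>U\<^sub>1(z\<^sub>1) \<otimes> \<dots> \<otimes> U\<^sub>r(z\<^sub>r) \<rightarrow> V\<^sub>1(\<xi>\<^sub>1) \<otimes> \<dots> \<otimes> V\<^sub>s(\<xi>\<^sub>s)\<close> intertwines, for each \<open>w\<close>,
  the actions of \<open>L\<close> on the single factors at \<open>w\<close>. Contracting all factors but \<open>V\<^sub>k\<close> with linear forms
  and freezing all factors but one on the left turns it into a nonzero \<open>L\<close>-homomorphism
  \<open>U\<^sub>j \<rightarrow> V\<^sub>k\<close> with \<open>z\<^sub>j = \<xi>\<^sub>k\<close>, which is bijective by irreducibility; if no \<open>z\<^sub>j\<close> equals \<open>\<xi>\<^sub>k\<close>, then \<open>L\<close> would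
  act as zero on \<open>V\<^sub>k\<close>. The representations may be infinite-dimensional, so nonzero linear forms come
  from Zorn's lemma.\<close>

section \<open>Complex vector spaces\<close>

text \<open>The grading ties the part of \<open>a\<close> in
  \<open>graded_part L \<sigma> N i\<close> to exponents in i/N + Z, so \<open>a\<close> cannot
  simply be multiplied by an interpolating polynomial p(t). It is split into its
  \<sigma>-eigencomponents a_i, each carried by t^(i/N) p(t) and rescaled by the inverse i-th power
  of the chosen root of w. At a point z the coefficient of a_i is p(z) times the i-th power of a
  quotient of two chosen roots. Hence vanishing is decided by p alone, whatever the branches are,
  and distinctness of the points themselves is enough.

  Nontriviality is what makes a point visible: a factor on which the algebra acts as zero could be
  moved to another point without changing the action. It enters through a vector \<open>v0\<close>
  of V_k with \<open>a0 v0\<close> nonzero. To see this vector from the left-hand side one needs a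
  map from the right-hand tensor product onto V_k that respects the separating elements, and this is
  where nonzero linear forms on the other factors are indispensable.

  No choice of matching is made in advance: each factor finds its partner by its point, and equality
  of the two sets of points gives both the equality of lengths and the permutation.\<close>

lemma complex_ring_simps [simp]:
  "carrier complex_ring = UNIV" "add complex_ring = (+)" "monoid.mult complex_ring = (*)"
  "zero complex_ring = 0" "one complex_ring = 1"
  by (simp_all add: ring_of_type_algebra_def)

locale complex_space = module complex_ring V
  for V :: "(complex, 'a, 'm) module_scheme" (structure)
begin

lemma scale_closed [simp, intro]: "x \<in> carrier V \<Longrightarrow> c \<odot> x \<in> carrier V"
  using smult_closed[of c x] by simp

lemma scale_add_left: "x \<in> carrier V \<Longrightarrow> (c + d) \<odot> x = c \<odot> x \<oplus> d \<odot> x"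
  using smult_l_distr[of c d x] by simp

lemma scale_add_right:
  "\<lbrakk>x \<in> carrier V; y \<in> carrier V\<rbrakk> \<Longrightarrow> c \<odot> (x \<oplus> y) = c \<odot> x \<oplus> c \<odot> y"
  using smult_r_distr[of c x y] by simp

lemma scale_scale: "x \<in> carrier V \<Longrightarrow> c \<odot> (d \<odot> x) = (c * d) \<odot> x"
  using smult_assoc1[of c d x] by simp

lemma scale_one [simp]: "x \<in> carrier V \<Longrightarrow> 1 \<odot> x = x"
  using smult_one[of x] by simp

lemma scale_zero_left [simp]: "x \<in> carrier V \<Longrightarrow> 0 \<odot> x = \<zero>"
  using smult_l_null[of x] by simp

lemma scale_zero_right [simp]: "c \<odot> \<zero> = \<zero>"
  using smult_r_null[of c] by simp

lemma scale_uminus: "x \<in> carrier V \<Longrightarrow> (- c) \<odot> x = \<ominus> (c \<odot> x)"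
  using scale_add_left[of x "- c" c] by (simp add: M.minus_equality)

lemma uminus_eq_scale: "x \<in> carrier V \<Longrightarrow> \<ominus> x = (- 1) \<odot> x"
  by (simp add: scale_uminus)

lemma finsum_scale_right:
  "\<lbrakk>finite A; f \<in> A \<rightarrow> carrier V\<rbrakk> \<Longrightarrow> c \<odot> (\<Oplus>i\<in>A. f i) = (\<Oplus>i\<in>A. c \<odot> f i)"
  using finsum_smult_ldistr[of A c f] by simp

lemma finsum_scale_left:
  "\<lbrakk>finite A; x \<in> carrier V\<rbrakk> \<Longrightarrow> (\<Sum>i\<in>A. h i) \<odot> x = (\<Oplus>i\<in>A. h i \<odot> x)"
  by (induction A rule: finite_induct) (simp_all add: scale_add_left)

lemma finsum_mono_neutral:
  assumes "finite B" "A \<subseteq> B" "\<And>i. i \<in> B - A \<Longrightarrow> f i = \<zero>" "f \<in> A \<rightarrow> carrier V"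
  shows "finsum V f A = finsum V f B"
  using assms by (intro add.finprod_mono_neutral_cong_left) auto

lemma finsum_swap:
  assumes "finite A" "finite B" "\<And>i j. i \<in> A \<Longrightarrow> j \<in> B \<Longrightarrow> h i j \<in> carrier V"
  shows "(\<Oplus>i\<in>A. \<Oplus>j\<in>B. h i j) = (\<Oplus>j\<in>B. \<Oplus>i\<in>A. h i j)"
  using assms(1,3)
proof (induction A rule: finite_induct)
  case empty
  then show ?case by simp
next
  case (insert i A)
  then show ?case
    using assms(2) by (simp add: finsum_addf Pi_def cong: finsum_cong)
qed

text \<open>Serves to split the power t^(p/N) into its integral part \<open>p div N\<close> and its
  residue \<open>p mod N\<close>. Each induction step appends one block of \<open>N\<close>
  consecutive exponents, on which the quotient is constant.\<close>

lemma finsum_div_mod: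
  fixes G :: "nat \<Rightarrow> nat \<Rightarrow> 'a"
  assumes "\<And>n i. G n i \<in> carrier V" and N: "N > 0"
  shows "(\<Oplus>p\<in>{..<N * D}. G (p div N) (p mod N)) = (\<Oplus>i\<in>{..<N}. \<Oplus>n\<in>{..<D}. G n i)"
proof (induction D)
  case 0
  then show ?case by simp
next
  case (Suc D)
  have "{..<N * Suc D} = {..<N * D} \<union> (\<lambda>i. N * D + i) ` {..<N}"
  proof -
    have "p \<in> (\<lambda>i. N * D + i) ` {..<N}" if "p < N * Suc D" "\<not> p < N * D" for p
      using that by (intro image_eqI[of _ _ "p - N * D"]) auto
    then show ?thesis by auto
  qed
  then have "(\<Oplus>p\<in>{..<N * Suc D}. G (p div N) (p mod N)) =
      (\<Oplus>p\<in>{..<N * D}. G (p div N) (p mod N)) \<oplus>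
      (\<Oplus>p\<in>(\<lambda>i. N * D + i) ` {..<N}. G (p div N) (p mod N))"
    using assms(1) by (simp only:) (intro M.finsum_Un_disjoint, auto)
  also have "(\<Oplus>p\<in>(\<lambda>i. N * D + i) ` {..<N}. G (p div N) (p mod N)) =
      (\<Oplus>i\<in>{..<N}. G ((N * D + i) div N) ((N * D + i) mod N))"
    using assms(1) by (intro M.finsum_reindex) auto
  also have "\<dots> = (\<Oplus>i\<in>{..<N}. G D i)"
    using assms by (intro M.finsum_cong') auto
  also have "(\<Oplus>p\<in>{..<N * D}. G (p div N) (p mod N)) \<oplus> (\<Oplus>i\<in>{..<N}. G D i) =
      (\<Oplus>i\<in>{..<N}. (\<Oplus>n\<in>{..<D}. G n i) \<oplus> G D i)"
    using assms(1) by (subst M.finsum_addf) (auto simp: Suc.IH)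
  also have "\<dots> = (\<Oplus>i\<in>{..<N}. \<Oplus>n\<in>{..<Suc D}. G n i)"
    using assms(1) by (intro M.finsum_cong') (auto simp: lessThan_Suc M.a_comm)
  finally show ?case .
qed

lemma subspaceI:
  assumes "H \<subseteq> carrier V" "\<zero> \<in> H"
    and "\<And>x y. x \<in> H \<Longrightarrow> y \<in> H \<Longrightarrow> x \<oplus> y \<in> H" "\<And>c x. x \<in> H \<Longrightarrow> c \<odot> x \<in> H"
  shows "submodule H complex_ring V"
proof (rule submoduleI)
  show "\<ominus> x \<in> H" if "x \<in> H" for x
    using assms(1) assms(4)[OF that, of "- 1"] that uminus_eq_scale[of x] by auto
qed (use assms in auto)

lemma subspaceD:
  assumes "submodule H complex_ring V"
  shows "H \<subseteq> carrier V" "\<zero> \<in> H"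
    and "\<And>x y. x \<in> H \<Longrightarrow> y \<in> H \<Longrightarrow> x \<oplus> y \<in> H" "\<And>c x. x \<in> H \<Longrightarrow> c \<odot> x \<in> H"
proof -
  show *: "H \<subseteq> carrier V" "\<And>x y. x \<in> H \<Longrightarrow> y \<in> H \<Longrightarrow> x \<oplus> y \<in> H"
    and **: "\<And>c x. x \<in> H \<Longrightarrow> c \<odot> x \<in> H"
    using submoduleE[OF assms] by auto
  obtain x where "x \<in> H" using submoduleE(2)[OF assms] by auto
  then show "\<zero> \<in> H" using *(1) **[of x 0] by auto
qed

lemma vspan_subspace:
  assumes "S \<subseteq> carrier V"
  shows "submodule (vspan V S) complex_ring V"
proof -
  have "carrier V \<in> {H. submodule H complex_ring V \<and> S \<subseteq> H}"
    using carrier_is_submodule assms by simp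
  then show ?thesis
    unfolding vspan_def by (intro subspaceI) (auto intro: subspaceD(3,4) dest: subspaceD(1,2))
qed

lemma vspan_superset: "S \<subseteq> vspan V S"
  by (auto simp: vspan_def)

lemma vspan_least: "\<lbrakk>submodule H complex_ring V; S \<subseteq> H\<rbrakk> \<Longrightarrow> vspan V S \<subseteq> H"
  by (auto simp: vspan_def)

text \<open>A subspace \<open>W\<close> maximal among those avoiding \<open>u\<close> is a
  complement of the line through \<open>u\<close>, and the form reads off the coefficient of
  \<open>u\<close> modulo \<open>W\<close>. Zorn's lemma replaces a basis, since no dimension is
  bounded.\<close>

lemma exists_linear_form:
  assumes "u \<in> carrier V" "u \<noteq> \<zero>"
  obtains f where "linear_form V (carrier V) f" "f u = 1"
proof -
  define \<A> where "\<A> = {H. submodule H complex_ring V \<and> u \<notin> H}"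
  have "\<exists>M\<in>\<A>. \<forall>H\<in>\<A>. M \<subseteq> H \<longrightarrow> H = M"
  proof (rule subset_Zorn)
    fix C assume C: "subset.chain \<A> C"
    show "\<exists>W\<in>\<A>. \<forall>H\<in>C. H \<subseteq> W"
    proof (cases "C = {}")
      case True
      have "{\<zero>} \<in> \<A>" using assms by (auto simp: \<A>_def intro!: subspaceI)
      then show ?thesis using True by auto
    next
      case False
      have mem: "H \<in> \<A>" if "H \<in> C" for H using C that by (auto simp: subset.chain_def)
      have "submodule (\<Union>C) complex_ring V"
      proof (rule subspaceI)
        show "\<zero> \<in> \<Union>C" using False mem subspaceD(2) by (auto simp: \<A>_def)
        show "x \<oplus> y \<in> \<Union>C" if xy: "x \<in> \<Union>C" "y \<in> \<Union>C" for x y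
        proof -
          obtain H K where HK: "H \<in> C" "K \<in> C" "x \<in> H" "y \<in> K" using xy by auto
          then have "H \<subseteq> K \<or> K \<subseteq> H" using C by (auto simp: subset_chain_def)
          then show ?thesis 
            using HK mem[of H] mem[of K] subspaceD(3)[of H x y] subspaceD(3)[of K x y]
            by (auto simp: \<A>_def)
        qed
        show "c \<odot> x \<in> \<Union>C" if "x \<in> \<Union>C" for c x
          using that mem subspaceD(4) unfolding \<A>_def by blast
        show "\<Union>C \<subseteq> carrier V" using mem subspaceD(1) unfolding \<A>_def by blast
      qed
      then have "\<Union>C \<in> \<A>" using mem by (auto simp: \<A>_def)
      then show ?thesis by auto
    qed
  qed
  then obtain W where W: "submodule W complex_ring V" "u \<notin> W"
    and max: "\<And>H. submodule H complex_ring V \<Longrightarrow> u \<notin> H \<Longrightarrow> W \<subseteq> H \<Longrightarrow> H = W"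
    unfolding \<A>_def by auto
  note W' = subspaceD[OF W(1)]
  have uW: "c = 0" if "c \<odot> u \<in> W" for c
    using W'(4)[OF that, of "inverse c"] W(2) assms by (cases "c = 0") (auto simp: scale_scale)
  have ex: "\<exists>c. v \<oplus> c \<odot> u \<in> W" if v: "v \<in> carrier V" for v
  proof (cases "v \<in> W")
    case True
    then show ?thesis using v assms by (intro exI[of _ 0]) simp
  next
    case False
    \<comment> \<open>\<open>H\<close> is \<open>W\<close> enlarged by the line through
      \<open>v\<close>. Maximality forces \<open>u\<close> into it, and in the resulting equation
      the coefficient of \<open>v\<close> is nonzero because \<open>u\<close> is not in
      \<open>W\<close>; so it can be solved for \<open>v\<close> modulo \<open>W\<close>.\<close>
    define H where "H = {w \<oplus> c \<odot> v |w c. w \<in> W}"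
    have "submodule H complex_ring V"
    proof (rule subspaceI)
      show "H \<subseteq> carrier V" using W'(1) v by (auto simp: H_def)
      show "\<zero> \<in> H" unfolding H_def using W'(1,2) v
        by (auto intro!: exI[of _ "\<zero>"] exI[of _ "0::complex"])
      show "x \<oplus> y \<in> H" if "x \<in> H" "y \<in> H" for x y
      proof -
        obtain w c w' c' where w: "x = w \<oplus> c \<odot> v" "w \<in> W" "y = w' \<oplus> c' \<odot> v" "w' \<in> W"
          using \<open>x \<in> H\<close> \<open>y \<in> H\<close> by (auto simp: H_def)
        have "w \<in> carrier V" "w' \<in> carrier V" using w W'(1) by auto
        then have "x \<oplus> y = (w \<oplus> w') \<oplus> (c + c') \<odot> v"
          using v w by (simp add: scale_add_left M.a_ac)
        then show ?thesis using W'(3)[of w w'] w by (auto simp: H_def)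
      qed
      show "d \<odot> x \<in> H" if "x \<in> H" for d x
      proof -
        obtain w c where w: "x = w \<oplus> c \<odot> v" "w \<in> W" using \<open>x \<in> H\<close> by (auto simp: H_def)
        have "w \<in> carrier V" using w W'(1) by auto
        then have "d \<odot> x = d \<odot> w \<oplus> (d * c) \<odot> v"
          using v w by (simp add: scale_add_right scale_scale)
        then show ?thesis using W'(4)[of w] w by (auto simp: H_def)
      qed
    qed
    moreover have "W \<subseteq> H"
    proof
      fix w assume "w \<in> W"
      then have "w = w \<oplus> 0 \<odot> v" using W'(1) v by auto
      then show "w \<in> H" unfolding H_def using \<open>w \<in> W\<close> by blast
    qed
    moreover have "v \<in> H"
    proof -
      have "v = \<zero> \<oplus> 1 \<odot> v" using v by simp
      then show ?thesis unfolding H_def using W'(2) by blast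
    qed
    ultimately have "u \<in> H" using max[of H] False by auto
    then obtain w c where w: "u = w \<oplus> c \<odot> v" "w \<in> W" by (auto simp: H_def)
    have wX: "w \<in> carrier V" using w W'(1) by auto
    have "c \<noteq> 0" using w wX v W(2) by auto
    have "\<ominus> w \<oplus> u = c \<odot> v" using w(1) wX v by (simp add: M.r_neg1)
    then have "inverse c \<odot> (\<ominus> w \<oplus> u) = v" using \<open>c \<noteq> 0\<close> v by (simp add: scale_scale)
    then have "v = inverse c \<odot> \<ominus> w \<oplus> inverse c \<odot> u"
      using wX assms by (simp add: scale_add_right)
    then have "v \<oplus> (- inverse c) \<odot> u = inverse c \<odot> \<ominus> w"
      using wX assms by (simp add: scale_uminus M.a_assoc M.r_neg)
    then show ?thesis using W'(4)[OF submoduleE(3)[OF W(1) w(2)], of "inverse c"] by metis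
  qed
  have uniq: "c = d" if "v \<in> carrier V" "v \<oplus> c \<odot> u \<in> W" "v \<oplus> d \<odot> u \<in> W" for v c d
  proof -
    have "(v \<oplus> c \<odot> u) \<oplus> (- 1) \<odot> (v \<oplus> d \<odot> u) \<in> W" using that W' by blast
    also have "(v \<oplus> c \<odot> u) \<oplus> (- 1) \<odot> (v \<oplus> d \<odot> u) = (v \<oplus> \<ominus> v) \<oplus> (c \<odot> u \<oplus> (- d) \<odot> u)"
      using that(1) assms(1) by (simp add: scale_add_right scale_uminus scale_scale M.a_ac M.minus_add)
    also have "\<dots> = (c - d) \<odot> u"
      using that(1) assms(1) scale_add_left[of u c "- d"] by (simp add: M.r_neg)
    finally show ?thesis using uW by fastforce
  qed
  \<comment> \<open>The sign: \<open>v \<oplus> c \<odot> u \<in> W\<close> says that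
    \<open>v\<close> is congruent to \<open>-c\<close> times \<open>u\<close> modulo
    \<open>W\<close>.\<close>
  define f where "f v = - (THE c. v \<oplus> c \<odot> u \<in> W)" for v
  have f: "f v = - c" if "v \<in> carrier V" "v \<oplus> c \<odot> u \<in> W" for v c
    unfolding f_def using uniq that by (metis (mono_tags, lifting) the_equality)
  show ?thesis
  proof (rule that)
    show "f u = 1"
    proof -
      have "u \<oplus> (- 1) \<odot> u \<in> W" using assms W'(2) by (simp add: scale_uminus M.r_neg)
      then show ?thesis using f[of u "- 1"] assms by simp
    qed
    show "linear_form V (carrier V) f"
      unfolding linear_form_def
    proof (intro conjI ballI allI)
      fix x y assume xy: "x \<in> carrier V" "y \<in> carrier V"
      obtain c d where cd: "x \<oplus> c \<odot> u \<in> W" "y \<oplus> d \<odot> u \<in> W" using ex xy by metis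
      have "(x \<oplus> c \<odot> u) \<oplus> (y \<oplus> d \<odot> u) = (x \<oplus> y) \<oplus> (c + d) \<odot> u"
        using xy assms(1) by (simp add: scale_add_left M.a_ac)
      then have "(x \<oplus> y) \<oplus> (c + d) \<odot> u \<in> W" using W'(3)[OF cd] by simp
      then show "f (x \<oplus> y) = f x + f y" using f cd xy by simp
    next
      fix a x assume x: "x \<in> carrier V"
      obtain c where c: "x \<oplus> c \<odot> u \<in> W" using ex x by metis
      have "a \<odot> (x \<oplus> c \<odot> u) = a \<odot> x \<oplus> (a * c) \<odot> u"
        using x assms(1) by (simp add: scale_add_right scale_scale)
      then have "a \<odot> x \<oplus> (a * c) \<odot> u \<in> W" using W'(4)[OF c, of a] by simp
      then show "f (a \<odot> x) = a * f x" using f[OF _ c] f x by simp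
    qed
  qed
qed

end

section \<open>Linear maps, kernels and images\<close>

definition linear_map ::
    "(complex, 'a, 'm) module_scheme \<Rightarrow> (complex, 'b, 'n) module_scheme \<Rightarrow> ('a \<Rightarrow> 'b) \<Rightarrow> bool" where
  "linear_map V V' g \<longleftrightarrow> g \<in> carrier V \<rightarrow> carrier V' \<and>
     (\<forall>x\<in>carrier V. \<forall>y\<in>carrier V. g (x \<oplus>\<^bsub>V\<^esub> y) = g x \<oplus>\<^bsub>V'\<^esub> g y) \<and>
     (\<forall>c. \<forall>x\<in>carrier V. g (c \<odot>\<^bsub>V\<^esub> x) = c \<odot>\<^bsub>V'\<^esub> g x)"

lemma linear_mapD:
  assumes "linear_map V V' g"
  shows "x \<in> carrier V \<Longrightarrow> g x \<in> carrier V'"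
    and "\<lbrakk>x \<in> carrier V; y \<in> carrier V\<rbrakk> \<Longrightarrow> g (x \<oplus>\<^bsub>V\<^esub> y) = g x \<oplus>\<^bsub>V'\<^esub> g y"
    and "x \<in> carrier V \<Longrightarrow> g (c \<odot>\<^bsub>V\<^esub> x) = c \<odot>\<^bsub>V'\<^esub> g x"
  using assms by (auto simp: linear_map_def)

lemma linear_map_comp:
  "\<lbrakk>linear_map V V' g; linear_map V' Z h\<rbrakk> \<Longrightarrow> linear_map V Z (\<lambda>x. h (g x))"
  by (simp add: linear_map_def Pi_def)

lemma linear_map_zero:
  assumes "complex_space V" "complex_space V'" "linear_map V V' g"
  shows "g \<zero>\<^bsub>V\<^esub> = \<zero>\<^bsub>V'\<^esub>"
proof -
  interpret V: complex_space V by fact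
  interpret V': complex_space V' by fact
  show ?thesis
    using linear_mapD(3)[OF assms(3), of "\<zero>\<^bsub>V\<^esub>" 0] linear_mapD(1)[OF assms(3), of "\<zero>\<^bsub>V\<^esub>"] by simp
qed

lemma linear_map_finsum:
  assumes "complex_space V" "complex_space V'" "linear_map V V' g"
    and "finite A" "f \<in> A \<rightarrow> carrier V"
  shows "g (finsum V f A) = finsum V' (\<lambda>i. g (f i)) A"
proof -
  interpret V: complex_space V by fact
  interpret V': complex_space V' by fact
  show ?thesis
    using assms(4,5)
    by (induction A rule: finite_induct)
      (simp_all add: linear_map_zero[OF assms(1-3)] linear_mapD[OF assms(3)] Pi_def)
qed

lemma linear_map_kernel:
  assumes "complex_space V" "complex_space V'" "linear_map V V' g"
  shows "submodule {x \<in> carrier V. g x = \<zero>\<^bsub>V'\<^esub>} complex_ring V"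
proof -
  interpret V: complex_space V by fact
  interpret V': complex_space V' by fact
  show ?thesis
    by (rule V.subspaceI)
      (auto simp: linear_map_zero[OF assms(1-3)] linear_mapD[OF assms(3)])
qed

lemma linear_map_image:
  assumes "complex_space V" "complex_space V'" "linear_map V V' g"
  shows "submodule (g ` carrier V) complex_ring V'"
proof -
  interpret V: complex_space V by fact
  interpret V': complex_space V' by fact
  show ?thesis
  proof (rule V'.subspaceI)
    show "\<zero>\<^bsub>V'\<^esub> \<in> g ` carrier V"
      by (metis linear_map_zero[OF assms(1-3)] V.M.zero_closed imageI)
  qed (auto simp: linear_mapD[OF assms(3)] simp flip: linear_mapD(2,3)[OF assms(3)])
qed

lemma linear_map_inj_on:
  assumes "complex_space V" "complex_space V'" "linear_map V V' g"
    and "\<And>x. x \<in> carrier V \<Longrightarrow> g x = \<zero>\<^bsub>V'\<^esub> \<Longrightarrow> x = \<zero>\<^bsub>V\<^esub>"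
  shows "inj_on g (carrier V)"
proof (rule inj_onI)
  interpret V: complex_space V by fact
  interpret V': complex_space V' by fact
  fix x y assume xy: "x \<in> carrier V" "y \<in> carrier V" "g x = g y"
  have "g (x \<oplus>\<^bsub>V\<^esub> (- 1) \<odot>\<^bsub>V\<^esub> y) = \<zero>\<^bsub>V'\<^esub>"
    using xy by (simp add: linear_mapD[OF assms(3)] V'.scale_uminus V'.M.r_neg)
  then have "x \<oplus>\<^bsub>V\<^esub> (- 1) \<odot>\<^bsub>V\<^esub> y = \<zero>\<^bsub>V\<^esub>" using assms(4) xy by simp
  then show "x = y" using xy by (simp add: V.scale_uminus) (metis V.M.add.inv_equality V.M.minus_minus V.M.a_inv_closed)
qed

section \<open>Quotients and tensor products\<close>

locale quotient_space = complex_space F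
  for F :: "('g, 'u) lie_module" (structure) +
  fixes W :: "'u set"
  assumes W: "submodule W complex_ring F"
begin

abbreviation "Q \<equiv> quotient_module F W"

lemma abelian_subgroup: "abelian_subgroup W F"
  by (intro abelian_subgroupI3 additive_subgroupI M.abelian_group_axioms)
    (use W in \<open>simp add: submodule_def\<close>)

lemma coset_self: "f \<in> carrier F \<Longrightarrow> f \<in> W +> f"
  by (rule abelian_subgroup.a_rcos_self[OF abelian_subgroup])

lemma coset_subset: "f \<in> carrier F \<Longrightarrow> W +> f \<subseteq> carrier F"
  using subspaceD(1)[OF W] by (rule a_r_coset_subset_G)

lemma mem_coset_iff:
  assumes "f \<in> carrier F" "g \<in> carrier F"
  shows "g \<in> W +> f \<longleftrightarrow> g \<oplus> (- 1) \<odot> f \<in> W"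
  using abelian_subgroup.a_rcos_module[OF abelian_subgroup assms(1,2)] assms
  by (simp add: scale_uminus)

lemma coset_eq_iff:
  assumes "f \<in> carrier F" "g \<in> carrier F"
  shows "W +> g = W +> f \<longleftrightarrow> g \<oplus> (- 1) \<odot> f \<in> W"
  using assms mem_coset_iff[OF assms] coset_self
    abelian_subgroup.a_repr_independence'[OF abelian_subgroup, of g f] by metis

lemma coset_zero: "W +> \<zero> = W"
  using subspaceD(1)[OF W] by simp

lemma coset_eq_zero_iff: "f \<in> carrier F \<Longrightarrow> W +> f = W \<longleftrightarrow> f \<in> W"
  using coset_eq_iff[of "\<zero>" f] coset_zero by simp

text \<open>Scalar multiplication and action on \<open>quotient_module\<close> are unions over all
  representatives of a coset. All members of the union coincide as soon as \<open>h\<close>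
  preserves \<open>W\<close>, since then \<open>h\<close> sends the difference of two
  representatives into \<open>W\<close>.\<close>

lemma UN_coset:
  assumes "f \<in> carrier F" "linear_map F F h" "\<And>w. w \<in> W \<Longrightarrow> h w \<in> W"
  shows "(\<Union>g\<in>W +> f. W +> h g) = W +> h f"
proof -
  have "W +> h g = W +> h f" if "g \<in> W +> f" for g
  proof -
    have g: "g \<in> carrier F" using that coset_subset assms(1) by blast
    have "h (g \<oplus> (- 1) \<odot> f) \<in> W" using assms that g mem_coset_iff by blast
    then have "h g \<oplus> (- 1) \<odot> h f \<in> W"
      using assms(1) g by (simp add: linear_mapD[OF assms(2)])
    then show ?thesis using g assms(1) coset_eq_iff linear_mapD(1)[OF assms(2)] by blast
  qed
  then show ?thesis using coset_self[OF assms(1)] by blast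
qed

lemma carrier_quotient: "carrier Q = (\<lambda>f. W +> f) ` carrier F"
  by (auto simp: quotient_module_def A_RCOSETS_def')

lemma zero_quotient: "\<zero>\<^bsub>Q\<^esub> = W"
  by (simp add: quotient_module_def)

lemma add_quotient:
  "\<lbrakk>f \<in> carrier F; g \<in> carrier F\<rbrakk> \<Longrightarrow> (W +> f) \<oplus>\<^bsub>Q\<^esub> (W +> g) = W +> (f \<oplus> g)"
  using abelian_subgroup.a_rcos_sum[OF abelian_subgroup] by (simp add: quotient_module_def)

lemma linear_map_scale: "linear_map F F (\<lambda>f. c \<odot> f)"
  by (simp add: linear_map_def scale_add_right scale_scale mult.commute)

lemma smult_quotient: "f \<in> carrier F \<Longrightarrow> c \<odot>\<^bsub>Q\<^esub> (W +> f) = W +> (c \<odot> f)"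
  using UN_coset[OF _ linear_map_scale] subspaceD(4)[OF W] by (simp add: quotient_module_def)

lemma act_quotient:
  assumes "linear_map F F (act F x)" "\<And>w. w \<in> W \<Longrightarrow> act F x w \<in> W" "f \<in> carrier F"
  shows "act Q x (W +> f) = W +> act F x f"
  using UN_coset[OF assms(3,1,2)] by (simp add: quotient_module_def)

lemma quotient_is_space: "complex_space Q"
proof (intro complex_space.intro moduleI abelian_groupI)
  show "cring complex_ring" by (rule R.is_cring)
  show "\<zero>\<^bsub>Q\<^esub> \<in> carrier Q"
    unfolding zero_quotient carrier_quotient using coset_zero by auto
  show "\<exists>y\<in>carrier Q. y \<oplus>\<^bsub>Q\<^esub> x = \<zero>\<^bsub>Q\<^esub>" if x: "x \<in> carrier Q" for x
  proof -
    obtain f where f: "x = W +> f" "f \<in> carrier F" using x unfolding carrier_quotient by blast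
    then have "(W +> (\<ominus> f)) \<oplus>\<^bsub>Q\<^esub> x = \<zero>\<^bsub>Q\<^esub>"
      by (simp add: add_quotient M.l_neg zero_quotient coset_zero)
    then show ?thesis using f unfolding carrier_quotient by blast
  qed
qed (auto simp: carrier_quotient add_quotient smult_quotient scale_add_left scale_add_right
    scale_scale M.a_ac zero_quotient add_quotient[of "\<zero>", unfolded coset_zero])

lemma linear_map_coset: "linear_map F Q (\<lambda>f. W +> f)"
  by (auto simp: linear_map_def carrier_quotient add_quotient smult_quotient)

text \<open>Two representatives of a coset differ by an element of \<open>W\<close>, which
  \<open>g\<close> kills; so evaluating \<open>g\<close> at an arbitrarily chosen representative is
  well defined.\<close>

lemma linear_map_quotient:
  assumes "complex_space V" "linear_map F V g" "\<And>w. w \<in> W \<Longrightarrow> g w = \<zero>\<^bsub>V\<^esub>"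
  obtains h where "linear_map Q V h" "\<And>f. f \<in> carrier F \<Longrightarrow> h (W +> f) = g f"
proof -
  interpret V: complex_space V by fact
  define h where "h C = g (SOME f. f \<in> C)" for C
  have h: "h (W +> f) = g f" if f: "f \<in> carrier F" for f
  proof -
    define f' where "f' = (SOME f'. f' \<in> W +> f)"
    have f': "f' \<in> W +> f" unfolding f'_def using coset_self[OF f] by (rule someI)
    then have f'F: "f' \<in> carrier F" using coset_subset f by blast
    have "g (f' \<oplus> (- 1) \<odot> f) = \<zero>\<^bsub>V\<^esub>" using f' f f'F mem_coset_iff assms(3) by blast
    then have "g f' \<oplus>\<^bsub>V\<^esub> \<ominus>\<^bsub>V\<^esub> g f = \<zero>\<^bsub>V\<^esub>"
      using f f'F by (simp add: linear_mapD[OF assms(2)] V.scale_uminus)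
    then show ?thesis
      using f f'F linear_mapD(1)[OF assms(2)] unfolding h_def f'_def[symmetric]
      by (metis V.M.add.inv_equality V.M.minus_minus V.M.a_inv_closed)
  qed
  have "linear_map Q V h"
    unfolding linear_map_def
    by (auto simp: carrier_quotient add_quotient smult_quotient h linear_mapD[OF assms(2)])
  then show ?thesis using h that by blast
qed

end

section \<open>Tensor products and their universal property\<close>

lemma linear_map_sum:
  assumes "complex_space V'" "finite J" "\<And>j. j \<in> J \<Longrightarrow> linear_map V V' (g j)"
  shows "linear_map V V' (\<lambda>x. \<Oplus>\<^bsub>V'\<^esub>j\<in>J. g j x)"
proof -
  interpret V': complex_space V' by fact
  note g = linear_mapD[OF assms(3)]
  show ?thesis
    unfolding linear_map_def using assms(2) g
    by (auto simp: V'.finsum_scale_right Pi_def intro!: V'.finsum_closed cong: V'.finsum_cong)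
qed

text \<open>The operators are indexed by a bare set \<open>A\<close>, each acting linearly on every
  factor. This is all that the Leibniz action on the tensor product requires, and it lets the same
  facts be used for the carrier of the twisted affine algebra, while equivariance can be restricted
  to a subset of separating elements.\<close>

locale tensor_product =
  fixes I :: "'i set" and M :: "'i \<Rightarrow> ('g, 'u) lie_module" and A :: "'g set"
  assumes finite_I: "finite I"
    and space: "i \<in> I \<Longrightarrow> complex_space (M i)"
    and act: "\<lbrakk>i \<in> I; a \<in> A\<rbrakk> \<Longrightarrow> linear_map (M i) (M i) (act (M i) a)"
begin

abbreviation "F \<equiv> free_module I M"
abbreviation "P \<equiv> \<Pi>\<^sub>E i\<in>I. carrier (M i)"
abbreviation "W \<equiv> vspan F (multilinear_relations I M)"
abbreviation "T \<equiv> tensor_module I M"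

definition pure :: "('i \<Rightarrow> 'u) \<Rightarrow> (('i \<Rightarrow> 'u) \<Rightarrow> complex) set" where
  "pure u = W +>\<^bsub>F\<^esub> basis_vec u"

lemma free_simps [simp]:
  "\<zero>\<^bsub>F\<^esub> = (\<lambda>_. 0)" "f \<oplus>\<^bsub>F\<^esub> g = (\<lambda>v. f v + g v)" "c \<odot>\<^bsub>F\<^esub> f = (\<lambda>v. c * f v)"
  by (simp_all add: free_module_def)

lemma carrier_free: "f \<in> carrier F \<longleftrightarrow> finite {u. f u \<noteq> 0} \<and> {u. f u \<noteq> 0} \<subseteq> P"
  by (simp add: free_module_def)

lemma add_closed_free:
  assumes "f \<in> carrier F" "g \<in> carrier F"
  shows "(\<lambda>v. f v + g v) \<in> carrier F"
proof -
  have "{u. f u + g u \<noteq> 0} \<subseteq> {u. f u \<noteq> 0} \<union> {u. g u \<noteq> 0}" by auto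
  moreover have "finite ({u. f u \<noteq> 0} \<union> {u. g u \<noteq> 0})" "{u. f u \<noteq> 0} \<union> {u. g u \<noteq> 0} \<subseteq> P"
    using assms by (auto simp: carrier_free)
  ultimately show ?thesis unfolding carrier_free by (meson finite_subset subset_trans)
qed

lemma scale_closed_free: "f \<in> carrier F \<Longrightarrow> (\<lambda>v. c * f v) \<in> carrier F"
  unfolding carrier_free by (cases "c = 0") auto

sublocale F: complex_space F
proof (intro complex_space.intro moduleI abelian_groupI)
  show "cring complex_ring" by (rule cring_from_type_algebra)
  show "\<exists>g\<in>carrier F. g \<oplus>\<^bsub>F\<^esub> f = \<zero>\<^bsub>F\<^esub>" if "f \<in> carrier F" for f
    using scale_closed_free[OF that, of "- 1"] by (intro bexI[of _ "\<lambda>v. - f v"]) auto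
qed (auto simp: add_closed_free scale_closed_free algebra_simps, simp add: carrier_free)

lemma basis_vec_closed [simp]: "u \<in> P \<Longrightarrow> basis_vec u \<in> carrier F"
  unfolding carrier_free by (auto simp: basis_vec_def)

lemma upd_closed [simp]: "\<lbrakk>u \<in> P; i \<in> I; x \<in> carrier (M i)\<rbrakk> \<Longrightarrow> u(i := x) \<in> P"
  by (auto simp: PiE_def extensional_def)

lemma coord_closed: "\<lbrakk>u \<in> P; i \<in> I\<rbrakk> \<Longrightarrow> u i \<in> carrier (M i)"
  by auto

text \<open>Induction on the finite support: one point is removed by resetting the function to 0
  there and restored as a multiple of a basis vector.\<close>

lemma free_induct [consumes 1, case_names zero add]:
  assumes "f \<in> carrier F" and "R \<zero>\<^bsub>F\<^esub>"
    and "\<And>f u c. \<lbrakk>f \<in> carrier F; u \<in> P; R f\<rbrakk> \<Longrightarrow> R (f \<oplus>\<^bsub>F\<^esub> c \<odot>\<^bsub>F\<^esub> basis_vec u)"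
  shows "R f"
proof -
  have "finite S \<Longrightarrow> f \<in> carrier F \<Longrightarrow> {u. f u \<noteq> 0} = S \<Longrightarrow> R f" for S f
  proof (induction S arbitrary: f rule: finite_induct)
    case empty
    then have "f = \<zero>\<^bsub>F\<^esub>" by auto
    then show ?case using assms(2) by simp
  next
    case (insert u S)
    define g where "g = f(u := 0)"
    have g: "{u. g u \<noteq> 0} = S" using insert unfolding g_def by auto
    then have gF: "g \<in> carrier F" using insert unfolding carrier_free by auto
    have "u \<in> P" using insert.prems unfolding carrier_free by auto
    then have "R (g \<oplus>\<^bsub>F\<^esub> f u \<odot>\<^bsub>F\<^esub> basis_vec u)" using assms(3) gF insert.IH[OF gF g] by blast
    also have "g \<oplus>\<^bsub>F\<^esub> f u \<odot>\<^bsub>F\<^esub> basis_vec u = f" by (auto simp: g_def basis_vec_def)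
    finally show ?case .
  qed
  then show ?thesis using assms(1) by (auto simp: carrier_free)
qed

lemma linear_map_free_eq:
  assumes "complex_space V" "linear_map F V g" "linear_map F V h"
    and "\<And>u. u \<in> P \<Longrightarrow> g (basis_vec u) = h (basis_vec u)" and "f \<in> carrier F"
  shows "g f = h f"
  using assms(5)
proof (induction rule: free_induct)
  case zero
  then show ?case using linear_map_zero[OF F.complex_space_axioms assms(1)] assms(2,3) by metis
next
  case (add f u c)
  note [simp del] = free_simps
  show ?case using add assms(4) by (simp add: linear_mapD[OF assms(2)] linear_mapD[OF assms(3)])
qed

text \<open>The linear extension of a map given on basis vectors. The sum runs over the exact
  support, which is finite for vectors of the free space.\<close>

definition lift :: "(complex, 'v, 'm) module_scheme \<Rightarrow> (('i \<Rightarrow> 'u) \<Rightarrow> 'v) \<Rightarrow> (('i \<Rightarrow> 'u) \<Rightarrow> complex) \<Rightarrow> 'v"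
  where "lift V \<beta> f = (\<Oplus>\<^bsub>V\<^esub>u\<in>{u. f u \<noteq> 0}. f u \<odot>\<^bsub>V\<^esub> \<beta> u)"

text \<open>The supports of two functions and of their sum differ. Extending all sums to one common
  finite set makes additivity a termwise matter.\<close>

lemma lift_superset:
  assumes "complex_space V" "\<beta> \<in> P \<rightarrow> carrier V" "finite S" "{u. f u \<noteq> 0} \<subseteq> S" "S \<subseteq> P"
  shows "lift V \<beta> f = (\<Oplus>\<^bsub>V\<^esub>u\<in>S. f u \<odot>\<^bsub>V\<^esub> \<beta> u)"
proof -
  interpret V: complex_space V by fact
  have "\<beta> u \<in> carrier V" if "u \<in> S" for u using that assms by auto
  then show ?thesis unfolding lift_def using assms(3,4) by (intro V.finsum_mono_neutral) auto
qed

lemma linear_map_lift: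
  assumes V: "complex_space V" and \<beta>: "\<beta> \<in> P \<rightarrow> carrier V"
  shows "linear_map F V (lift V \<beta>)"
proof -
  interpret V: complex_space V by fact
  have \<beta>': "\<beta> u \<in> carrier V" if "u \<in> P" for u using that \<beta> by auto
  show ?thesis
    unfolding linear_map_def
  proof (intro conjI ballI allI)
    show "lift V \<beta> \<in> carrier F \<rightarrow> carrier V"
    proof (rule Pi_I)
      fix f assume "f \<in> carrier F"
      then have "\<beta> u \<in> carrier V" if "f u \<noteq> 0" for u using that \<beta>' by (auto simp: carrier_free)
      then show "lift V \<beta> f \<in> carrier V" unfolding lift_def by (intro V.finsum_closed) auto
    qed
    fix f assume f: "f \<in> carrier F"
    {
      fix g assume g: "g \<in> carrier F"
      let ?S = "{u. f u \<noteq> 0} \<union> {u. g u \<noteq> 0}"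
      have S: "finite ?S" "?S \<subseteq> P" using f g by (auto simp: carrier_free)
      have \<beta>S: "\<beta> u \<in> carrier V" if "u \<in> ?S" for u using that S \<beta>' by blast
      have "lift V \<beta> (f \<oplus>\<^bsub>F\<^esub> g) = (\<Oplus>\<^bsub>V\<^esub>u\<in>?S. (f u + g u) \<odot>\<^bsub>V\<^esub> \<beta> u)"
        by (subst lift_superset[OF V \<beta> S(1) _ S(2)]) auto
      also have "\<dots> = (\<Oplus>\<^bsub>V\<^esub>u\<in>?S. f u \<odot>\<^bsub>V\<^esub> \<beta> u \<oplus>\<^bsub>V\<^esub> g u \<odot>\<^bsub>V\<^esub> \<beta> u)"
        using \<beta>S by (intro V.finsum_cong) (auto simp: V.scale_add_left)
      also have "\<dots> = (\<Oplus>\<^bsub>V\<^esub>u\<in>?S. f u \<odot>\<^bsub>V\<^esub> \<beta> u) \<oplus>\<^bsub>V\<^esub> (\<Oplus>\<^bsub>V\<^esub>u\<in>?S. g u \<odot>\<^bsub>V\<^esub> \<beta> u)"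
        using \<beta>S by (intro V.finsum_addf) auto
      also have "\<dots> = lift V \<beta> f \<oplus>\<^bsub>V\<^esub> lift V \<beta> g"
        using lift_superset[OF V \<beta> S(1) _ S(2)] by auto
      finally show "lift V \<beta> (f \<oplus>\<^bsub>F\<^esub> g) = lift V \<beta> f \<oplus>\<^bsub>V\<^esub> lift V \<beta> g" .
    }
    fix c
    let ?S = "{u. f u \<noteq> 0}"
    have S: "finite ?S" "?S \<subseteq> P" using f by (auto simp: carrier_free)
    have \<beta>S: "\<beta> u \<in> carrier V" if "u \<in> ?S" for u using that S \<beta>' by blast
    have "lift V \<beta> (c \<odot>\<^bsub>F\<^esub> f) = (\<Oplus>\<^bsub>V\<^esub>u\<in>?S. (c * f u) \<odot>\<^bsub>V\<^esub> \<beta> u)"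
      by (subst lift_superset[OF V \<beta> S(1) _ S(2)]) auto
    also have "\<dots> = (\<Oplus>\<^bsub>V\<^esub>u\<in>?S. c \<odot>\<^bsub>V\<^esub> (f u \<odot>\<^bsub>V\<^esub> \<beta> u))"
      using \<beta>S by (intro V.finsum_cong) (auto simp: V.scale_scale)
    also have "\<dots> = c \<odot>\<^bsub>V\<^esub> lift V \<beta> f"
      unfolding lift_def using \<beta>S S by (intro V.finsum_scale_right[symmetric]) auto
    finally show "lift V \<beta> (c \<odot>\<^bsub>F\<^esub> f) = c \<odot>\<^bsub>V\<^esub> lift V \<beta> f" .
  qed
qed

lemma lift_basis_vec:
  assumes "complex_space V" "\<beta> \<in> P \<rightarrow> carrier V" "u \<in> P"
  shows "lift V \<beta> (basis_vec u) = \<beta> u"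
proof -
  interpret V: complex_space V by fact
  have "{v. basis_vec u v \<noteq> 0} = {u}" "basis_vec u u = 1" by (auto simp: basis_vec_def)
  moreover have "\<beta> u \<in> carrier V" using assms by auto
  ultimately show ?thesis by (simp add: lift_def)
qed

definition multilinear :: "(complex, 'v, 'm) module_scheme \<Rightarrow> (('i \<Rightarrow> 'u) \<Rightarrow> 'v) \<Rightarrow> bool" where
  "multilinear V \<beta> \<longleftrightarrow> (\<forall>u\<in>P. \<forall>i\<in>I. linear_map (M i) V (\<lambda>x. \<beta> (u(i := x)))) \<and> \<beta> \<in> P \<rightarrow> carrier V"

text \<open>Turns the pointwise generators into expressions in the module operations of
  \<open>F\<close>, to which linear maps and coset criteria apply.\<close>

lemma relation_eqs:
  "(\<lambda>v. basis_vec a v - basis_vec b v - basis_vec c v) =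
     basis_vec a \<oplus>\<^bsub>F\<^esub> (- 1) \<odot>\<^bsub>F\<^esub> (basis_vec b \<oplus>\<^bsub>F\<^esub> basis_vec c)"
  "(\<lambda>v. basis_vec a v - d * basis_vec b v) =
     basis_vec a \<oplus>\<^bsub>F\<^esub> (- 1) \<odot>\<^bsub>F\<^esub> (d \<odot>\<^bsub>F\<^esub> basis_vec b)"
  by (auto simp: fun_eq_iff)

lemma relations_subset: "multilinear_relations I M \<subseteq> carrier F"
proof
  fix f assume "f \<in> multilinear_relations I M"
  then show "f \<in> carrier F"
    unfolding multilinear_relations_def relation_eqs
  proof (elim UnE CollectE exE conjE)
    fix u i x y
    assume *: "f = basis_vec (u(i := x \<oplus>\<^bsub>M i\<^esub> y)) \<oplus>\<^bsub>F\<^esub>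
        (- 1) \<odot>\<^bsub>F\<^esub> (basis_vec (u(i := x)) \<oplus>\<^bsub>F\<^esub> basis_vec (u(i := y)))"
      "u \<in> P" "i \<in> I" "x \<in> carrier (M i)" "y \<in> carrier (M i)"
    interpret Mi: complex_space "M i" using space * by blast
    show ?thesis unfolding *(1)
      using * by (intro F.M.a_closed F.scale_closed basis_vec_closed upd_closed Mi.M.a_closed)
  next
    fix u i c x
    assume *: "f = basis_vec (u(i := c \<odot>\<^bsub>M i\<^esub> x)) \<oplus>\<^bsub>F\<^esub>
        (- 1) \<odot>\<^bsub>F\<^esub> (c \<odot>\<^bsub>F\<^esub> basis_vec (u(i := x)))"
      "u \<in> P" "i \<in> I" "x \<in> carrier (M i)"
    interpret Mi: complex_space "M i" using space * by blast
    show ?thesis unfolding *(1)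
      using * by (intro F.M.a_closed F.scale_closed basis_vec_closed upd_closed Mi.scale_closed)
  qed
qed

sublocale quot: quotient_space F W
  by (rule quotient_space.intro[OF F.complex_space_axioms quotient_space_axioms.intro
      [OF F.vspan_subspace[OF relations_subset]]])

lemma tensor_eq_quotient: "T = quotient_module F W"
  by (simp add: tensor_module_def)

sublocale T: complex_space T
  unfolding tensor_eq_quotient by (rule quot.quotient_is_space)

lemma linear_map_coset: "linear_map F T (\<lambda>f. W +>\<^bsub>F\<^esub> f)"
  unfolding tensor_eq_quotient by (rule quot.linear_map_coset)

lemma carrier_tensor: "carrier T = (\<lambda>f. W +>\<^bsub>F\<^esub> f) ` carrier F"
  unfolding tensor_eq_quotient by (rule quot.carrier_quotient)

lemma pure_closed [simp]: "u \<in> P \<Longrightarrow> pure u \<in> carrier T"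
  by (simp add: carrier_tensor pure_def)

lemma multilinear_pure: "multilinear T pure"
  unfolding multilinear_def linear_map_def
proof (intro conjI ballI allI)
  fix u i assume ui: "u \<in> P" "i \<in> I"
  interpret Mi: complex_space "M i" using space ui by blast
  note [simp del] = free_simps
  show "(\<lambda>x. pure (u(i := x))) \<in> carrier (M i) \<rightarrow> carrier T"
    using ui by simp
  fix x assume x: "x \<in> carrier (M i)"
  {
    fix y assume y: "y \<in> carrier (M i)"
    have "basis_vec (u(i := x \<oplus>\<^bsub>M i\<^esub> y)) \<oplus>\<^bsub>F\<^esub>
        (- 1) \<odot>\<^bsub>F\<^esub> (basis_vec (u(i := x)) \<oplus>\<^bsub>F\<^esub> basis_vec (u(i := y))) \<in> W"
      unfolding relation_eqs[symmetric]
      by (rule set_mp[OF F.vspan_superset]) (use ui x y in \<open>unfold multilinear_relations_def, blast\<close>)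
    then have "W +>\<^bsub>F\<^esub> basis_vec (u(i := x \<oplus>\<^bsub>M i\<^esub> y)) =
        W +>\<^bsub>F\<^esub> (basis_vec (u(i := x)) \<oplus>\<^bsub>F\<^esub> basis_vec (u(i := y)))"
      using ui x y by (subst quot.coset_eq_iff) simp_all
    then show "pure (u(i := x \<oplus>\<^bsub>M i\<^esub> y)) = pure (u(i := x)) \<oplus>\<^bsub>T\<^esub> pure (u(i := y))"
      using ui x y by (simp add: pure_def linear_mapD(2)[OF linear_map_coset])
  }
  fix c
  have "basis_vec (u(i := c \<odot>\<^bsub>M i\<^esub> x)) \<oplus>\<^bsub>F\<^esub>
      (- 1) \<odot>\<^bsub>F\<^esub> (c \<odot>\<^bsub>F\<^esub> basis_vec (u(i := x))) \<in> W"
    unfolding relation_eqs[symmetric]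
    by (rule set_mp[OF F.vspan_superset]) (use ui x in \<open>unfold multilinear_relations_def, blast\<close>)
  then have "W +>\<^bsub>F\<^esub> basis_vec (u(i := c \<odot>\<^bsub>M i\<^esub> x)) = W +>\<^bsub>F\<^esub> (c \<odot>\<^bsub>F\<^esub> basis_vec (u(i := x)))"
    using ui x by (subst quot.coset_eq_iff) simp_all
  then show "pure (u(i := c \<odot>\<^bsub>M i\<^esub> x)) = c \<odot>\<^bsub>T\<^esub> pure (u(i := x))"
    using ui x by (simp add: pure_def linear_mapD(3)[OF linear_map_coset])
qed simp

text \<open>The kernel of the linear extension is a subspace, so it contains the span once it
  contains the generators; on these the claim is the multilinearity of
  \<open>\<beta>\<close>.\<close>

lemma lift_kills_relations:
  assumes V: "complex_space V" and \<beta>: "multilinear V \<beta>" and "w \<in> W"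
  shows "lift V \<beta> w = \<zero>\<^bsub>V\<^esub>"
proof -
  interpret V: complex_space V by fact
  note [simp del] = free_simps
  have \<beta>P: "\<beta> \<in> P \<rightarrow> carrier V" using \<beta> by (simp add: multilinear_def)
  have lin: "linear_map (M i) V (\<lambda>x. \<beta> (u(i := x)))" if "u \<in> P" "i \<in> I" for u i
    using \<beta> that by (simp add: multilinear_def)
  note L = linear_map_lift[OF V \<beta>P]
  have zero: "a \<oplus>\<^bsub>V\<^esub> (- 1) \<odot>\<^bsub>V\<^esub> a = \<zero>\<^bsub>V\<^esub>" if "a \<in> carrier V" for a
    using that by (simp add: V.scale_uminus V.M.r_neg)
  have "W \<subseteq> {f \<in> carrier F. lift V \<beta> f = \<zero>\<^bsub>V\<^esub>}"
  proof (rule F.vspan_least[OF linear_map_kernel[OF F.complex_space_axioms V L]], rule subsetI)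
    fix f assume f: "f \<in> multilinear_relations I M"
    have "lift V \<beta> f = \<zero>\<^bsub>V\<^esub>"
      using f unfolding multilinear_relations_def relation_eqs
    proof (elim UnE CollectE exE conjE)
      fix u i x y
      assume *: "f = basis_vec (u(i := x \<oplus>\<^bsub>M i\<^esub> y)) \<oplus>\<^bsub>F\<^esub>
          (- 1) \<odot>\<^bsub>F\<^esub> (basis_vec (u(i := x)) \<oplus>\<^bsub>F\<^esub> basis_vec (u(i := y)))"
        "u \<in> P" "i \<in> I" "x \<in> carrier (M i)" "y \<in> carrier (M i)"
      interpret Mi: complex_space "M i" using space * by blast
      show ?thesis unfolding *(1)
        using *(2-) linear_mapD[OF lin[OF *(2,3)]]
        by (simp add: linear_mapD[OF L] lift_basis_vec[OF V \<beta>P] zero)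
    next
      fix u i c x
      assume *: "f = basis_vec (u(i := c \<odot>\<^bsub>M i\<^esub> x)) \<oplus>\<^bsub>F\<^esub>
          (- 1) \<odot>\<^bsub>F\<^esub> (c \<odot>\<^bsub>F\<^esub> basis_vec (u(i := x)))"
        "u \<in> P" "i \<in> I" "x \<in> carrier (M i)"
      interpret Mi: complex_space "M i" using space * by blast
      show ?thesis unfolding *(1)
        using *(2-) linear_mapD[OF lin[OF *(2,3)]]
        by (simp add: linear_mapD[OF L] lift_basis_vec[OF V \<beta>P] zero)
    qed
    then show "f \<in> {f \<in> carrier F. lift V \<beta> f = \<zero>\<^bsub>V\<^esub>}" using f relations_subset by auto
  qed
  then show ?thesis using \<open>w \<in> W\<close> by auto
qed

lemma universal:
  assumes V: "complex_space V" and \<beta>: "multilinear V \<beta>"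
  obtains h where "linear_map T V h" "\<And>u. u \<in> P \<Longrightarrow> h (pure u) = \<beta> u"
proof -
  have \<beta>P: "\<beta> \<in> P \<rightarrow> carrier V" using \<beta> by (simp add: multilinear_def)
  obtain h where h: "linear_map T V h" "\<And>f. f \<in> carrier F \<Longrightarrow> h (W +>\<^bsub>F\<^esub> f) = lift V \<beta> f"
    using quot.linear_map_quotient[OF V linear_map_lift[OF V \<beta>P] lift_kills_relations[OF V \<beta>]]
    unfolding tensor_eq_quotient by metis
  then show ?thesis using that by (simp add: pure_def lift_basis_vec[OF V \<beta>P])
qed

text \<open>Pure tensors are the images of the basis vectors of the free space and therefore
  determine a linear map. Identities on the whole tensor product are reduced to pure tensors in this
  way.\<close>

lemma linear_map_tensor_eq:
  assumes V: "complex_space V" and g: "linear_map T V g" and h: "linear_map T V h"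
    and eq: "\<And>u. u \<in> P \<Longrightarrow> g (pure u) = h (pure u)" and t: "t \<in> carrier T"
  shows "g t = h t"
proof -
  obtain f where f: "f \<in> carrier F" "t = W +>\<^bsub>F\<^esub> f" using t unfolding carrier_tensor by auto
  show ?thesis unfolding f(2)
    by (rule linear_map_free_eq[OF V linear_map_comp[OF linear_map_coset g]
          linear_map_comp[OF linear_map_coset h] _ f(1)])
      (simp add: eq flip: pure_def)
qed

section \<open>The Leibniz action on tensor products\<close>

lemma finsum_free:
  "\<lbrakk>finite J; g \<in> J \<rightarrow> carrier F\<rbrakk> \<Longrightarrow> finsum F g J = (\<lambda>v. \<Sum>j\<in>J. g j v)"
  by (induction J rule: finite_induct) (auto simp: Pi_def)

lemma act_closed_coord: "\<lbrakk>u \<in> P; i \<in> I; a \<in> A\<rbrakk> \<Longrightarrow> u(i := act (M i) a (u i)) \<in> P"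
  using linear_mapD(1)[OF act, of i a "u i"] coord_closed by simp

text \<open>Exhibits the action as the linear extension of the Leibniz rule on basis vectors, so
  that its linearity is that of \<open>lift\<close>.\<close>

lemma act_free_eq_lift:
  assumes f: "f \<in> carrier F" and a: "a \<in> A"
  shows "act F a f = lift F (\<lambda>u. \<Oplus>\<^bsub>F\<^esub>i\<in>I. basis_vec (u(i := act (M i) a (u i)))) f"
proof -
  have 1: "(\<Oplus>\<^bsub>F\<^esub>i\<in>I. basis_vec (u(i := act (M i) a (u i)))) =
      (\<lambda>v. \<Sum>i\<in>I. basis_vec (u(i := act (M i) a (u i))) v)" if "u \<in> P" for u
    using that a by (intro finsum_free finite_I) (intro Pi_I basis_vec_closed act_closed_coord)
  have "(\<lambda>u. \<Oplus>\<^bsub>F\<^esub>i\<in>I. basis_vec (u(i := act (M i) a (u i)))) \<in> P \<rightarrow> carrier F"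
    using a by (intro Pi_I F.finsum_closed basis_vec_closed act_closed_coord)
  then have "lift F (\<lambda>u. \<Oplus>\<^bsub>F\<^esub>i\<in>I. basis_vec (u(i := act (M i) a (u i)))) f =
      (\<lambda>v. \<Sum>u\<in>{u. f u \<noteq> 0}. (f u \<odot>\<^bsub>F\<^esub> (\<Oplus>\<^bsub>F\<^esub>i\<in>I. basis_vec (u(i := act (M i) a (u i))))) v)"
    unfolding lift_def using f unfolding carrier_free
    by (intro finsum_free) (auto simp del: free_simps intro!: F.scale_closed)
  also have "\<dots> = act F a f"
    using f unfolding carrier_free
    by (auto simp: free_module_def 1[unfolded free_module_def] fun_eq_iff intro!: sum.cong)
  finally show ?thesis by simp
qed

lemma linear_map_act_free:
  assumes "a \<in> A"
  shows "linear_map F F (act F a)"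
proof -
  have "linear_map F F (lift F (\<lambda>u. \<Oplus>\<^bsub>F\<^esub>i\<in>I. basis_vec (u(i := act (M i) a (u i)))))"
    using assms
    by (intro linear_map_lift F.complex_space_axioms)
      (intro Pi_I F.finsum_closed basis_vec_closed act_closed_coord)
  then show ?thesis
    unfolding linear_map_def using act_free_eq_lift[OF _ assms] F.M.a_closed F.scale_closed by auto
qed

lemma act_free_basis_vec:
  assumes "a \<in> A" "u \<in> P"
  shows "act F a (basis_vec u) = (\<Oplus>\<^bsub>F\<^esub>i\<in>I. basis_vec (u(i := act (M i) a (u i))))"
  unfolding act_free_eq_lift[OF basis_vec_closed[OF assms(2)] assms(1)] using assms
  by (intro lift_basis_vec F.complex_space_axioms)
      (intro Pi_I F.finsum_closed basis_vec_closed act_closed_coord)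

lemma coset_act_free:
  assumes "a \<in> A" "u \<in> P"
  shows "W +>\<^bsub>F\<^esub> act F a (basis_vec u) = (\<Oplus>\<^bsub>T\<^esub>i\<in>I. pure (u(i := act (M i) a (u i))))"
  unfolding act_free_basis_vec[OF assms] pure_def using assms
  by (intro linear_map_finsum[OF F.complex_space_axioms T.complex_space_axioms linear_map_coset finite_I]
       Pi_I basis_vec_closed act_closed_coord)

lemma multilinear_act:
  assumes a: "a \<in> A"
  shows "multilinear T (\<lambda>u. \<Oplus>\<^bsub>T\<^esub>i\<in>I. pure (u(i := act (M i) a (u i))))"
  unfolding multilinear_def
proof (intro conjI ballI)
  show "(\<lambda>u. \<Oplus>\<^bsub>T\<^esub>i\<in>I. pure (u(i := act (M i) a (u i)))) \<in> P \<rightarrow> carrier T"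
    using a by (intro Pi_I T.finsum_closed pure_closed act_closed_coord)
  fix u j assume u: "u \<in> P" and j: "j \<in> I"
  show "linear_map (M j) T
      (\<lambda>x. \<Oplus>\<^bsub>T\<^esub>i\<in>I. pure ((u(j := x))(i := act (M i) a ((u(j := x)) i))))"
  proof (rule linear_map_sum[OF T.complex_space_axioms finite_I])
    fix i assume i: "i \<in> I"
    have lin: "linear_map (M j) T (\<lambda>x. pure (v(j := x)))" if "v \<in> P" for v
      using multilinear_pure that j by (simp add: multilinear_def)
    \<comment> \<open>In the summand \<open>i\<close> the variable slot \<open>j\<close> is either
      the one acted on, which composes with the linear operator, or a spectator, in which case the
      action only changes the fixed tuple around it.\<close>
    show "linear_map (M j) T (\<lambda>x. pure ((u(j := x))(i := act (M i) a ((u(j := x)) i))))"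
    proof (cases "i = j")
      case True
      then show ?thesis using linear_map_comp[OF act[OF j a] lin[OF u]] by simp
    next
      case False
      then show ?thesis using lin[OF act_closed_coord[OF u i a]] by (simp add: fun_upd_twist)
    qed
  qed
qed

text \<open>Avoids acting on the individual generators. Acting and then projecting to
  \<open>T\<close> agrees on basis vectors with the linear extension of the Leibniz sum; that sum is
  multilinear, so its extension kills \<open>W\<close>.\<close>

lemma act_free_relations:
  assumes a: "a \<in> A" and w: "w \<in> W"
  shows "act F a w \<in> W"
proof -
  let ?\<beta> = "\<lambda>u. \<Oplus>\<^bsub>T\<^esub>i\<in>I. pure (u(i := act (M i) a (u i)))"
  have wF: "w \<in> carrier F" using w F.subspaceD(1)[OF quot.W] by auto
  have \<beta>: "?\<beta> \<in> P \<rightarrow> carrier T" using multilinear_act[OF a] by (simp add: multilinear_def)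
  have "W +>\<^bsub>F\<^esub> act F a w = lift T ?\<beta> w"
    by (rule linear_map_free_eq[OF T.complex_space_axioms
          linear_map_comp[OF linear_map_act_free[OF a] linear_map_coset]
          linear_map_lift[OF T.complex_space_axioms \<beta>] _ wF])
      (simp add: coset_act_free[OF a] lift_basis_vec[OF T.complex_space_axioms \<beta>])
  also have "\<dots> = W"
    using lift_kills_relations[OF T.complex_space_axioms multilinear_act[OF a] w]
    by (simp add: tensor_eq_quotient quot.zero_quotient)
  finally show ?thesis
    using quot.coset_eq_zero_iff linear_mapD(1)[OF linear_map_act_free[OF a] wF] by blast
qed

lemma act_coset:
  "\<lbrakk>a \<in> A; f \<in> carrier F\<rbrakk> \<Longrightarrow> act T a (W +>\<^bsub>F\<^esub> f) = W +>\<^bsub>F\<^esub> act F a f"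
  unfolding tensor_eq_quotient
  by (rule quot.act_quotient[OF linear_map_act_free act_free_relations])

lemma act_pure:
  "\<lbrakk>a \<in> A; u \<in> P\<rbrakk> \<Longrightarrow> act T a (pure u) = (\<Oplus>\<^bsub>T\<^esub>i\<in>I. pure (u(i := act (M i) a (u i))))"
  using coset_act_free[of a u] act_coset[of a "basis_vec u"] by (simp add: pure_def)

lemma linear_map_act_tensor:
  assumes a: "a \<in> A"
  shows "linear_map T T (act T a)"
proof -
  note c = linear_mapD[OF linear_map_coset] and l = linear_mapD[OF linear_map_act_free[OF a]]
  note [simp del] = free_simps
  show ?thesis
    unfolding linear_map_def carrier_tensor
    by (auto simp: act_coset[OF a] l c(2,3)[symmetric])
qed

end

section \<open>Equivariant maps: contraction and functoriality\<close>

definition equivariant_map ::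
    "'g set \<Rightarrow> ('g, 'u, 'm) lie_module_scheme \<Rightarrow> ('g, 'v, 'n) lie_module_scheme \<Rightarrow>
     ('u \<Rightarrow> 'v) \<Rightarrow> bool" where
  "equivariant_map A M M' \<phi> \<longleftrightarrow> linear_map M M' \<phi> \<and>
     (\<forall>a\<in>A. \<forall>u\<in>carrier M. \<phi> (act M a u) = act M' a (\<phi> u))"

lemma equivariant_mapD:
  assumes "equivariant_map A M M' \<phi>"
  shows "linear_map M M' \<phi>"
    and "\<lbrakk>a \<in> A; u \<in> carrier M\<rbrakk> \<Longrightarrow> \<phi> (act M a u) = act M' a (\<phi> u)"
  using assms by (simp_all add: equivariant_map_def)

context tensor_product
begin

lemma pure_zero:
  assumes "u \<in> P" "i \<in> I"
  shows "pure (u(i := \<zero>\<^bsub>M i\<^esub>)) = \<zero>\<^bsub>T\<^esub>"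
  using linear_map_zero[OF space T.complex_space_axioms, of i "\<lambda>x. pure (u(i := x))"] multilinear_pure assms
  by (simp add: multilinear_def)

lemma act_pure_zero:
  assumes "a \<in> A" "u \<in> P" and zero: "\<And>i v. i \<in> I \<Longrightarrow> v \<in> carrier (M i) \<Longrightarrow> act (M i) a v = \<zero>\<^bsub>M i\<^esub>"
  shows "act T a (pure u) = \<zero>\<^bsub>T\<^esub>"
  unfolding act_pure[OF assms(1,2)] using assms(2) zero coord_closed pure_zero
  by (intro T.add.finprod_one_eqI) simp

text \<open>Every other Leibniz summand is a pure tensor with a zero component.\<close>

lemma act_pure_single:
  assumes "a \<in> A" "u \<in> P" and k: "k \<in> I"
    and zero: "\<And>i v. i \<in> I \<Longrightarrow> i \<noteq> k \<Longrightarrow> v \<in> carrier (M i) \<Longrightarrow> act (M i) a v = \<zero>\<^bsub>M i\<^esub>"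
  shows "act T a (pure u) = pure (u(k := act (M k) a (u k)))"
proof -
  have c: "pure (u(k := act (M k) a (u k))) \<in> carrier T"
    using assms by (intro pure_closed act_closed_coord)
  have "act T a (pure u) = (\<Oplus>\<^bsub>T\<^esub>i\<in>{k}. pure (u(i := act (M i) a (u i))))"
    unfolding act_pure[OF assms(1,2)] using assms finite_I zero coord_closed pure_zero c
    by (intro T.finsum_mono_neutral[symmetric]) auto
  then show ?thesis using c by simp
qed

lemma act_tensor_zero:
  assumes a: "a \<in> A" and zero: "\<And>i v. i \<in> I \<Longrightarrow> v \<in> carrier (M i) \<Longrightarrow> act (M i) a v = \<zero>\<^bsub>M i\<^esub>"
    and t: "t \<in> carrier T"
  shows "act T a t = \<zero>\<^bsub>T\<^esub>"
proof (rule linear_map_tensor_eq[OF T.complex_space_axioms linear_map_act_tensor[OF a] _ _ t])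
  show "linear_map T T (\<lambda>_. \<zero>\<^bsub>T\<^esub>)" by (simp add: linear_map_def)
qed (use a zero in \<open>simp add: act_pure_zero\<close>)

text \<open>The map sends a pure tensor \<open>u\<close> to \<open>u k\<close> multiplied by the values of fixed nonzero linear
  forms at the other components.\<close>

lemma contraction:
  assumes k: "k \<in> I" and nonzero: "\<And>i. i \<in> I \<Longrightarrow> carrier (M i) \<noteq> {\<zero>\<^bsub>M i\<^esub>}"
    and E: "E \<subseteq> A"
      "\<And>a i v. \<lbrakk>a \<in> E; i \<in> I; i \<noteq> k; v \<in> carrier (M i)\<rbrakk> \<Longrightarrow> act (M i) a v = \<zero>\<^bsub>M i\<^esub>"
  shows "\<exists>K. equivariant_map E T (M k) K \<and> K ` carrier T = carrier (M k)"
proof -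
  interpret Mk: complex_space "M k" using space k by blast
  have "\<exists>w f. w \<in> carrier (M i) \<and> linear_form (M i) (carrier (M i)) f \<and> f w = 1" if i: "i \<in> I" for i
  proof -
    interpret Mi: complex_space "M i" using space i by blast
    obtain w where w: "w \<in> carrier (M i)" "w \<noteq> \<zero>\<^bsub>M i\<^esub>"
      using nonzero[OF i] Mi.M.zero_closed by blast
    obtain f where "linear_form (M i) (carrier (M i)) f" "f w = 1"
      by (rule Mi.exists_linear_form[OF w])
    then show ?thesis using w(1) by blast
  qed
  then obtain w f where w: "\<And>i. i \<in> I \<Longrightarrow> w i \<in> carrier (M i)" "\<And>i. i \<in> I \<Longrightarrow> f i (w i) = 1"
    and f: "\<And>i. i \<in> I \<Longrightarrow> linear_form (M i) (carrier (M i)) (f i)" by metis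
  define \<beta> where "\<beta> u = (\<Prod>i\<in>I - {k}. f i (u i)) \<odot>\<^bsub>M k\<^esub> u k" for u
  have others: "(\<Prod>i\<in>I - {k}. f i ((u(k := x)) i)) = (\<Prod>i\<in>I - {k}. f i (u i))" for u x
    by (rule prod.cong) auto
  have "multilinear (M k) \<beta>"
    unfolding multilinear_def
  proof (intro conjI ballI)
    show "\<beta> \<in> P \<rightarrow> carrier (M k)" using k coord_closed by (auto simp: \<beta>_def)
    fix u i assume u: "u \<in> P" and i: "i \<in> I"
    interpret Mi: complex_space "M i" using space i by blast
    have uk: "u k \<in> carrier (M k)" using u k coord_closed by blast
    show "linear_map (M i) (M k) (\<lambda>x. \<beta> (u(i := x)))"
    proof (cases "i = k")
      case True
      then have "\<beta> (u(i := x)) = (\<Prod>i\<in>I - {k}. f i (u i)) \<odot>\<^bsub>M k\<^esub> x" for x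
        unfolding \<beta>_def using others by simp
      then show ?thesis using True
        by (simp add: linear_map_def Mk.scale_add_right Mk.scale_scale mult.commute)
    next
      case False
      \<comment> \<open>The contribution of the slots other than \<open>k\<close> and
        \<open>i\<close>; what remains depends on slot \<open>i\<close> only through the linear form
        \<open>f i\<close>.\<close>
      define c where "c = (\<Prod>j\<in>I - {k} - {i}. f j (u j))"
      have "(\<Prod>j\<in>I - {k}. f j ((u(i := x)) j)) = f i x * c" for x
        using finite_I i False prod.remove[of "I - {k}" i "\<lambda>j. f j ((u(i := x)) j)"]
        by (simp add: c_def)
      then have "\<beta> (u(i := x)) = (f i x * c) \<odot>\<^bsub>M k\<^esub> u k" for x
        unfolding \<beta>_def using False by simp
      then show ?thesis using f[OF i] uk
        by (simp add: linear_map_def linear_form_def Mk.scale_add_left Mk.scale_scale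
            distrib_right mult.assoc)
    qed
  qed
  then obtain K where K: "linear_map T (M k) K" "\<And>u. u \<in> P \<Longrightarrow> K (pure u) = \<beta> u"
    using universal[OF Mk.complex_space_axioms] by metis
  show ?thesis
    unfolding equivariant_map_def
  proof (intro exI[of _ K] conjI ballI K(1))
    show "K ` carrier T = carrier (M k)"
    proof
      show "K ` carrier T \<subseteq> carrier (M k)" using linear_mapD(1)[OF K(1)] by blast
      show "carrier (M k) \<subseteq> K ` carrier T"
      proof
        fix v assume v: "v \<in> carrier (M k)"
        \<comment> \<open>The slots other than \<open>k\<close> are filled with vectors on which the
          forms take the value 1, so that the contraction returns \<open>v\<close> itself.\<close>
        define u where "u = (\<lambda>i\<in>I. if i = k then v else w i)"
        have u: "u \<in> P" using v w by (auto simp: u_def)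
        have "(\<Prod>i\<in>I - {k}. f i (u i)) = 1" using w by (intro prod.neutral) (auto simp: u_def)
        then have "v = K (pure u)" using K(2)[OF u] v k by (simp add: \<beta>_def u_def)
        then show "v \<in> K ` carrier T" using pure_closed[OF u] by (rule image_eqI)
      qed
    qed
    fix a t
    assume aE: "a \<in> E" and t: "t \<in> carrier T"
    have a: "a \<in> A" using aE E(1) by blast
    show "K (act T a t) = act (M k) a (K t)"
    proof (rule linear_map_tensor_eq[OF Mk.complex_space_axioms
          linear_map_comp[OF linear_map_act_tensor[OF a] K(1)]
          linear_map_comp[OF K(1) act[OF k a]] _ t])
      fix u assume u: "u \<in> P"
      have uk: "u k \<in> carrier (M k)" using u k coord_closed by blast
      have "K (act T a (pure u)) = \<beta> (u(k := act (M k) a (u k)))"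
        using act_pure_single[OF a u k E(2)[OF aE]] K(2)[OF act_closed_coord[OF u k a]] by simp
      also have "\<dots> = (\<Prod>i\<in>I - {k}. f i (u i)) \<odot>\<^bsub>M k\<^esub> act (M k) a (u k)"
        unfolding \<beta>_def others by simp
      also have "\<dots> = act (M k) a (\<beta> u)"
        using linear_mapD(3)[OF act[OF k a] uk] by (simp add: \<beta>_def)
      finally show "K (act T a (pure u)) = act (M k) a (K (pure u))" using K(2)[OF u] by simp
    qed
  qed
qed

text \<open>Functoriality of the tensor product along a relabelling of the factors. The inverse
  \<open>\<rho>\<close> of \<open>\<pi>\<close> is a parameter, so that a caller can apply the lemma
  a second time with the two maps exchanged.\<close>

lemma tensor_hom:
  fixes J :: "'j set" and M' :: "'j \<Rightarrow> ('g, 'v) lie_module"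
  assumes T': "tensor_product J M' A"
    and \<pi>: "bij_betw \<pi> I J" and \<rho>: "\<And>i. i \<in> I \<Longrightarrow> \<rho> (\<pi> i) = i"
    and \<psi>: "\<And>i. i \<in> I \<Longrightarrow> equivariant_map A (M i) (M' (\<pi> i)) (\<psi> i)"
  shows "\<exists>h. equivariant_map A T (tensor_module J M') h \<and>
    (\<forall>u\<in>P. h (pure u) = tensor_product.pure J M' (\<lambda>j\<in>J. \<psi> (\<rho> j) (u (\<rho> j))))"
proof -
  interpret T': tensor_product J M' A by fact
  define \<Psi> where "\<Psi> u = (\<lambda>j\<in>J. \<psi> (\<rho> j) (u (\<rho> j)))" for u
  have \<pi>J: "\<pi> i \<in> J" if "i \<in> I" for i using \<pi> that by (auto simp: bij_betw_def)
  have \<rho>I: "\<rho> j \<in> I" "\<pi> (\<rho> j) = j" if "j \<in> J" for j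
    using \<pi> that \<rho> by (auto simp: bij_betw_def)
  have \<Psi>P: "\<Psi> u \<in> T'.P" if "u \<in> P" for u
    using that \<rho>I linear_mapD(1)[OF equivariant_mapD(1)[OF \<psi>[OF \<rho>I(1)]]] coord_closed by (auto simp: \<Psi>_def)
  have \<Psi>\<pi>: "\<Psi> u (\<pi> i) = \<psi> i (u i)" if "i \<in> I" for u i
    using that \<pi>J \<rho> by (simp add: \<Psi>_def)
  \<comment> \<open>Changing slot \<open>i\<close> changes exactly slot \<open>\<pi> i\<close> of
    the image tuple. Both multilinearity and the comparison of Leibniz summands rest on
    this.\<close>
  have \<Psi>_upd: "\<Psi> (u(i := x)) = (\<Psi> u)(\<pi> i := \<psi> i x)" if "i \<in> I" for u i x
    using that \<pi>J \<rho> \<rho>I by (auto simp: \<Psi>_def fun_eq_iff restrict_def)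
  have "multilinear T'.T (\<lambda>u. T'.pure (\<Psi> u))"
    unfolding multilinear_def
  proof (intro conjI ballI)
    show "(\<lambda>u. T'.pure (\<Psi> u)) \<in> P \<rightarrow> carrier T'.T"
      by (intro Pi_I T'.pure_closed \<Psi>P)
    fix u i assume u: "u \<in> P" and i: "i \<in> I"
    have "linear_map (M' (\<pi> i)) T'.T (\<lambda>x. T'.pure ((\<Psi> u)(\<pi> i := x)))"
      using T'.multilinear_pure \<Psi>P[OF u] \<pi>J[OF i] by (simp add: T'.multilinear_def)
    then show "linear_map (M i) T'.T (\<lambda>x. T'.pure (\<Psi> (u(i := x))))"
      using linear_map_comp[OF equivariant_mapD(1)[OF \<psi>[OF i]]] by (simp add: \<Psi>_upd[OF i])
  qed
  then obtain h where h: "linear_map T T'.T h" "\<And>u. u \<in> P \<Longrightarrow> h (pure u) = T'.pure (\<Psi> u)"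
    using universal[OF T'.T.complex_space_axioms] by metis
  show ?thesis
    unfolding equivariant_map_def
  proof (intro exI[of _ h] conjI ballI h(1))
    show "h (pure u) = T'.pure (\<lambda>j\<in>J. \<psi> (\<rho> j) (u (\<rho> j)))" if "u \<in> P" for u
      using h(2)[OF that] by (simp add: \<Psi>_def)
    fix a t assume a: "a \<in> A" and t: "t \<in> carrier T"
    show "h (act T a t) = act T'.T a (h t)"
    proof (rule linear_map_tensor_eq[OF T'.T.complex_space_axioms
          linear_map_comp[OF linear_map_act_tensor[OF a] h(1)]
          linear_map_comp[OF h(1) T'.linear_map_act_tensor[OF a]] _ t])
      fix u assume u: "u \<in> P"
      have "h (act T a (pure u)) = (\<Oplus>\<^bsub>T'.T\<^esub>i\<in>I. h (pure (u(i := act (M i) a (u i)))))"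
        unfolding act_pure[OF a u]
        by (rule linear_map_finsum[OF T.complex_space_axioms T'.T.complex_space_axioms h(1) finite_I])
          (intro Pi_I pure_closed act_closed_coord u a)
      also have "\<dots> = (\<Oplus>\<^bsub>T'.T\<^esub>i\<in>I. T'.pure ((\<Psi> u)(\<pi> i := act (M' (\<pi> i)) a (\<Psi> u (\<pi> i)))))"
      proof (rule T'.T.finsum_cong'[OF refl])
        show "(\<lambda>i. T'.pure ((\<Psi> u)(\<pi> i := act (M' (\<pi> i)) a (\<Psi> u (\<pi> i))))) \<in> I \<rightarrow> carrier T'.T"
          by (intro Pi_I T'.pure_closed T'.act_closed_coord \<Psi>P u a \<pi>J)
        fix i assume i: "i \<in> I"
        show "h (pure (u(i := act (M i) a (u i)))) =
            T'.pure ((\<Psi> u)(\<pi> i := act (M' (\<pi> i)) a (\<Psi> u (\<pi> i))))"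
          using h(2)[OF act_closed_coord[OF u i a]] equivariant_mapD(2)[OF \<psi>[OF i] a coord_closed[OF u i]]
          by (simp add: \<Psi>_upd[OF i] \<Psi>\<pi>[OF i])
      qed
      \<comment> \<open>The Leibniz sum over \<open>I\<close> is relabelled as the one over
        \<open>J\<close>.\<close>
      also have "\<dots> = (\<Oplus>\<^bsub>T'.T\<^esub>j\<in>\<pi> ` I. T'.pure ((\<Psi> u)(j := act (M' j) a (\<Psi> u j))))"
      proof (rule T'.T.finsum_reindex[symmetric])
        show "inj_on \<pi> I" using \<pi> by (simp add: bij_betw_def)
        show "(\<lambda>j. T'.pure ((\<Psi> u)(j := act (M' j) a (\<Psi> u j)))) \<in> \<pi> ` I \<rightarrow> carrier T'.T"
          by (intro Pi_I T'.pure_closed T'.act_closed_coord \<Psi>P u a) (use \<pi>J in auto)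
      qed
      also have "\<dots> = act T'.T a (h (pure u))"
        using \<pi> T'.act_pure[OF a \<Psi>P[OF u]] h(2)[OF u] by (simp add: bij_betw_def)
      finally show "h (act T a (pure u)) = act T'.T a (h (pure u))" .
    qed
  qed
qed

end

section \<open>Isomorphisms, extraction of a factor, and Schur's lemma\<close>

lemma lie_module_isomorphic_iff:
  "lie_module_isomorphic L M M' \<longleftrightarrow>
     (\<exists>\<phi>. equivariant_map (carrier L) M M' \<phi> \<and> bij_betw \<phi> (carrier M) (carrier M'))"
  unfolding lie_module_isomorphic_def equivariant_map_def linear_map_def
  by (rule arg_cong[where f = Ex]) (auto simp: fun_eq_iff dest: bij_betw_imp_funcset)

lemma equivariant_map_inverse:
  assumes "complex_space M" "equivariant_map A M M' \<phi>" "bij_betw \<phi> (carrier M) (carrier M')"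
    and "\<And>x u. \<lbrakk>x \<in> A; u \<in> carrier M\<rbrakk> \<Longrightarrow> act M x u \<in> carrier M"
  shows "equivariant_map A M' M (inv_into (carrier M) \<phi>)"
proof -
  interpret M: complex_space M by fact
  let ?\<psi> = "inv_into (carrier M) \<phi>"
  have inv: "?\<psi> (\<phi> u) = u" if "u \<in> carrier M" for u
    using that assms(3) by (simp add: bij_betw_def)
  have surj: "\<exists>u\<in>carrier M. v = \<phi> u" if "v \<in> carrier M'" for v
    using that assms(3) by (auto simp: bij_betw_def)
  note \<phi> = linear_mapD[OF equivariant_mapD(1)[OF assms(2)]]
  have "linear_map M' M ?\<psi>"
    unfolding linear_map_def
    by (auto dest!: surj simp: inv simp flip: \<phi>(2,3))
  moreover have "?\<psi> (act M' x u) = act M x (?\<psi> u)" if "x \<in> A" "u \<in> carrier M'" for x u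
    using that surj[of u] by (auto simp: inv assms(4) simp flip: equivariant_mapD(2)[OF assms(2)])
  ultimately show ?thesis by (simp add: equivariant_map_def)
qed

lemma lie_module_isomorphic_sym:
  assumes "lie_module_isomorphic L M M'" "complex_space M"
    and "\<And>x u. \<lbrakk>x \<in> carrier L; u \<in> carrier M\<rbrakk> \<Longrightarrow> act M x u \<in> carrier M"
  shows "lie_module_isomorphic L M' M"
proof -
  obtain \<phi> where \<phi>: "equivariant_map (carrier L) M M' \<phi> \<and> bij_betw \<phi> (carrier M) (carrier M')"
    using assms(1) unfolding lie_module_isomorphic_iff ..
  then show ?thesis
    unfolding lie_module_isomorphic_iff
    using equivariant_map_inverse[OF assms(2) _ _ assms(3)] bij_betw_inv_into by blast
qed

text \<open>The factorwise isomorphisms and their inverses induce maps in both directions. The two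
  composites fix every pure tensor and are therefore identities.\<close>

lemma tensor_isomorphic:
  assumes T: "tensor_product I M (carrier L)" and T': "tensor_product J M' (carrier L)"
    and \<pi>: "bij_betw \<pi> I J"
    and iso: "\<And>i. i \<in> I \<Longrightarrow> lie_module_isomorphic L (M i) (M' (\<pi> i))"
  shows "lie_module_isomorphic L (tensor_module I M) (tensor_module J M')"
proof -
  interpret T: tensor_product I M "carrier L" by fact
  interpret T': tensor_product J M' "carrier L" by fact
  define \<rho> where "\<rho> = inv_into I \<pi>"
  have \<rho>: "bij_betw \<rho> J I" "\<And>i. i \<in> I \<Longrightarrow> \<rho> (\<pi> i) = i" "\<And>j. j \<in> J \<Longrightarrow> \<pi> (\<rho> j) = j"
    using \<pi> by (auto simp: \<rho>_def bij_betw_inv_into bij_betw_inv_into_left bij_betw_inv_into_right)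
  have \<rho>I: "\<rho> j \<in> I" if "j \<in> J" for j using \<rho>(1) that by (auto simp: bij_betw_def)
  have \<pi>J: "\<pi> i \<in> J" if "i \<in> I" for i using \<pi> that by (auto simp: bij_betw_def)
  have "\<forall>i\<in>I. \<exists>\<phi>. equivariant_map (carrier L) (M i) (M' (\<pi> i)) \<phi> \<and>
      bij_betw \<phi> (carrier (M i)) (carrier (M' (\<pi> i)))"
    using iso unfolding lie_module_isomorphic_iff ..
  then obtain \<psi> where "\<forall>i\<in>I. equivariant_map (carrier L) (M i) (M' (\<pi> i)) (\<psi> i) \<and>
      bij_betw (\<psi> i) (carrier (M i)) (carrier (M' (\<pi> i)))"
    unfolding bchoice_iff ..
  then have \<psi>: "equivariant_map (carrier L) (M i) (M' (\<pi> i)) (\<psi> i)"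
      "bij_betw (\<psi> i) (carrier (M i)) (carrier (M' (\<pi> i)))" if "i \<in> I" for i
    using that by simp_all
  define \<psi>' where "\<psi>' j = inv_into (carrier (M (\<rho> j))) (\<psi> (\<rho> j))" for j
  have \<psi>': "equivariant_map (carrier L) (M' j) (M (\<rho> j)) (\<psi>' j)" if "j \<in> J" for j
    using equivariant_map_inverse[OF T.space \<psi> linear_mapD(1)[OF T.act], of "\<rho> j"] \<rho>I[OF that]
    by (simp add: \<psi>'_def \<rho>(3)[OF that])
  obtain h where "equivariant_map (carrier L) T.T T'.T h \<and>
      (\<forall>u\<in>T.P. h (T.pure u) = T'.pure (\<lambda>j\<in>J. \<psi> (\<rho> j) (u (\<rho> j))))"
    using T.tensor_hom[OF T' \<pi> \<rho>(2) \<psi>(1)] ..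
  then have h: "equivariant_map (carrier L) T.T T'.T h" "linear_map T.T T'.T h"
    "\<And>u. u \<in> T.P \<Longrightarrow> h (T.pure u) = T'.pure (\<lambda>j\<in>J. \<psi> (\<rho> j) (u (\<rho> j)))"
    by (simp_all add: equivariant_map_def)
  obtain h' where "equivariant_map (carrier L) T'.T T.T h' \<and>
      (\<forall>u\<in>T'.P. h' (T'.pure u) = T.pure (\<lambda>i\<in>I. \<psi>' (\<pi> i) (u (\<pi> i))))"
    using T'.tensor_hom[OF T \<rho>(1,3) \<psi>'] ..
  then have h': "linear_map T'.T T.T h'"
    "\<And>u. u \<in> T'.P \<Longrightarrow> h' (T'.pure u) = T.pure (\<lambda>i\<in>I. \<psi>' (\<pi> i) (u (\<pi> i)))"
    by (simp_all add: equivariant_map_def)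
  have P': "(\<lambda>j\<in>J. \<psi> (\<rho> j) (u (\<rho> j))) \<in> T'.P" if "u \<in> T.P" for u
    using that linear_mapD(1)[OF equivariant_mapD(1)[OF \<psi>(1)[OF \<rho>I]]] \<rho>I \<rho>(3) T.coord_closed by fastforce
  have P: "(\<lambda>i\<in>I. \<psi>' (\<pi> i) (u (\<pi> i))) \<in> T.P" if "u \<in> T'.P" for u
    using that linear_mapD(1)[OF equivariant_mapD(1)[OF \<psi>'[OF \<pi>J]]] \<pi>J \<rho>(2) T'.coord_closed by fastforce
  have "h' (h t) = t" if t: "t \<in> carrier T.T" for t
  proof (rule T.linear_map_tensor_eq[OF T.T.complex_space_axioms linear_map_comp[OF h(2) h'(1)] _ _ t])
    show "linear_map T.T T.T (\<lambda>t. t)" by (simp add: linear_map_def)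
    fix u assume u: "u \<in> T.P"
    have "(\<lambda>i\<in>I. \<psi>' (\<pi> i) ((\<lambda>j\<in>J. \<psi> (\<rho> j) (u (\<rho> j))) (\<pi> i))) = u"
    proof
      fix i
      show "(\<lambda>i\<in>I. \<psi>' (\<pi> i) ((\<lambda>j\<in>J. \<psi> (\<rho> j) (u (\<rho> j))) (\<pi> i))) i = u i"
        using u T.coord_closed[OF u] \<pi>J \<rho>(2) \<psi>(2)
        by (cases "i \<in> I") (auto simp: \<psi>'_def bij_betw_def PiE_def extensional_def)
    qed
    then show "h' (h (T.pure u)) = T.pure u" using h(3)[OF u] h'(2)[OF P'[OF u]] by simp
  qed
  moreover have "h (h' t) = t" if t: "t \<in> carrier T'.T" for t
  proof (rule T'.linear_map_tensor_eq[OF T'.T.complex_space_axioms linear_map_comp[OF h'(1) h(2)] _ _ t])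
    show "linear_map T'.T T'.T (\<lambda>t. t)" by (simp add: linear_map_def)
    fix u assume u: "u \<in> T'.P"
    have "(\<lambda>j\<in>J. \<psi> (\<rho> j) ((\<lambda>i\<in>I. \<psi>' (\<pi> i) (u (\<pi> i))) (\<rho> j))) = u"
    proof
      fix j
      show "(\<lambda>j\<in>J. \<psi> (\<rho> j) ((\<lambda>i\<in>I. \<psi>' (\<pi> i) (u (\<pi> i))) (\<rho> j))) j = u j"
        using u T'.coord_closed[OF u] \<rho>I \<rho>(3) bij_betw_inv_into_right[OF \<psi>(2)[OF \<rho>I]]
        by (cases "j \<in> J") (auto simp: \<psi>'_def PiE_def extensional_def)
    qed
    then show "h (h' (T'.pure u)) = T'.pure u" using h'(2)[OF u] h(3)[OF P[OF u]] by simp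
  qed
  ultimately have "bij_betw h (carrier T.T) (carrier T'.T)"
    using linear_mapD(1)[OF h(2)] linear_mapD(1)[OF h'(1)]
    by (intro bij_betw_byWitness[where f' = h']) auto
  then show ?thesis unfolding lie_module_isomorphic_iff using h(1) by blast
qed

text \<open>A surjective homomorphism followed by a contraction is nonzero on some pure tensor; letting one
  of its components vary gives the required map.\<close>

lemma surjection_factor:
  assumes T: "tensor_product I M A" and T': "tensor_product J M' A"
    and \<phi>: "equivariant_map A (tensor_module I M) (tensor_module J M') \<phi>"
      "\<phi> ` carrier (tensor_module I M) = carrier (tensor_module J M')"
    and k: "k \<in> J" and nonzero: "\<And>j. j \<in> J \<Longrightarrow> carrier (M' j) \<noteq> {\<zero>\<^bsub>M' j\<^esub>}"
    and E: "E \<subseteq> A"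
      "\<And>a j v. \<lbrakk>a \<in> E; j \<in> J; j \<noteq> k; v \<in> carrier (M' j)\<rbrakk> \<Longrightarrow> act (M' j) a v = \<zero>\<^bsub>M' j\<^esub>"
    and S: "S \<subseteq> I" "\<And>i i'. i \<in> S \<Longrightarrow> i' \<in> S \<Longrightarrow> i = i'"
      "\<And>a i v. \<lbrakk>a \<in> E; i \<in> I; i \<notin> S; v \<in> carrier (M i)\<rbrakk> \<Longrightarrow> act (M i) a v = \<zero>\<^bsub>M i\<^esub>"
    and nontrivial: "a0 \<in> E" "v0 \<in> carrier (M' k)" "act (M' k) a0 v0 \<noteq> \<zero>\<^bsub>M' k\<^esub>"
  shows "\<exists>i\<in>S. \<exists>\<psi>. equivariant_map E (M i) (M' k) \<psi> \<and> (\<exists>x\<in>carrier (M i). \<psi> x \<noteq> \<zero>\<^bsub>M' k\<^esub>)"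
proof -
  interpret T: tensor_product I M A by fact
  interpret T': tensor_product J M' A by fact
  interpret Mk: complex_space "M' k" using T'.space k by blast
  obtain K where "equivariant_map E T'.T (M' k) K \<and> K ` carrier T'.T = carrier (M' k)"
    using T'.contraction[OF k nonzero E] ..
  then have K: "linear_map T'.T (M' k) K" "K ` carrier T'.T = carrier (M' k)"
    "\<And>a t. \<lbrakk>a \<in> E; t \<in> carrier T'.T\<rbrakk> \<Longrightarrow> K (act T'.T a t) = act (M' k) a (K t)"
    by (simp_all add: equivariant_map_def)
  note \<phi>_lin = equivariant_mapD(1)[OF \<phi>(1)]
  define C where "C t = K (\<phi> t)" for t
  have C: "linear_map T.T (M' k) C"
    unfolding C_def by (rule linear_map_comp[OF \<phi>_lin K(1)])
  have C_act: "C (act T.T a t) = act (M' k) a (C t)" if a: "a \<in> E" and t: "t \<in> carrier T.T" for a t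
  proof -
    have "a \<in> A" using a E(1) by blast
    then show ?thesis
      using equivariant_mapD(2)[OF \<phi>(1) _ t] K(3)[OF a linear_mapD(1)[OF \<phi>_lin t]]
      by (simp add: C_def)
  qed
  \<comment> \<open>Both maps are onto, so the vector witnessing nontriviality comes from some
    \<open>t\<close> on the left.\<close>
  have "v0 \<in> K ` \<phi> ` carrier T.T" using nontrivial(2) \<phi>(2) K(2) by simp
  then obtain t where t: "t \<in> carrier T.T" "C t = v0" unfolding C_def by auto
  \<comment> \<open>Were \<open>S\<close> empty, \<open>a0\<close> would act as zero on every factor
    on the left, hence on \<open>t\<close>; equivariance of \<open>C\<close> would then make
    \<open>a0\<close> kill \<open>v0\<close>.\<close>
  have "S \<noteq> {}"
  proof
    assume "S = {}"
    then have "act T.T a0 t = \<zero>\<^bsub>T.T\<^esub>"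
      using S(3) nontrivial(1) E(1) by (intro T.act_tensor_zero[OF _ _ t(1)]) auto
    then show False
      using C_act[OF nontrivial(1) t(1)] t(2) nontrivial(3)
        linear_map_zero[OF T.T.complex_space_axioms Mk.complex_space_axioms C] by simp
  qed
  then obtain i where i: "i \<in> S" by blast
  have iI: "i \<in> I" using i S(1) by blast
  \<comment> \<open>Since \<open>S\<close> has at most one element, the operators in
    \<open>E\<close> vanish on every factor except the \<open>i\<close>-th; on pure tensors they
    move only that slot.\<close>
  have notS: "i' \<notin> S" if "i' \<noteq> i" for i' using S(2) i that by blast
  have "\<exists>u\<in>T.P. C (T.pure u) \<noteq> \<zero>\<^bsub>M' k\<^esub>"
  proof (rule ccontr)
    assume *: "\<not> ?thesis"
    have "C t = \<zero>\<^bsub>M' k\<^esub>"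
    proof (rule T.linear_map_tensor_eq[OF Mk.complex_space_axioms C _ _ t(1)])
      show "linear_map T.T (M' k) (\<lambda>_. \<zero>\<^bsub>M' k\<^esub>)" by (simp add: linear_map_def)
    qed (use * in blast)
    moreover have "a0 \<in> A" using nontrivial(1) E(1) by blast
    ultimately show False
      using t(2) nontrivial(3) linear_map_zero[OF Mk.complex_space_axioms Mk.complex_space_axioms
          T'.act[OF k, of a0]] by simp
  qed
  then obtain u where u: "u \<in> T.P" "C (T.pure u) \<noteq> \<zero>\<^bsub>M' k\<^esub>" by blast
  define \<psi> where "\<psi> x = C (T.pure (u(i := x)))" for x
  have "linear_map (M i) (M' k) \<psi>"
    unfolding \<psi>_def using T.multilinear_pure u(1) iI
    by (intro linear_map_comp[OF _ C]) (simp add: T.multilinear_def)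
  moreover have "\<psi> (act (M i) a x) = act (M' k) a (\<psi> x)" if a: "a \<in> E" and x: "x \<in> carrier (M i)" for a x
  proof -
    have ux: "u(i := x) \<in> T.P" using u iI x by (intro T.upd_closed)
    have "act T.T a (T.pure (u(i := x))) = T.pure ((u(i := x))(i := act (M i) a ((u(i := x)) i)))"
      using a E(1) S(3) notS by (intro T.act_pure_single[OF _ ux iI]) auto
    then show ?thesis
      using C_act[OF a T.pure_closed[OF ux]] by (simp add: \<psi>_def)
  qed
  moreover have "\<psi> (u i) \<noteq> \<zero>\<^bsub>M' k\<^esub>" using u(2) by (simp add: \<psi>_def)
  ultimately show ?thesis
    using i T.coord_closed[OF u(1) iI] unfolding equivariant_map_def by blast
qed

text \<open>Kernel and image are invariant subspaces. The vector \<open>x\<close> shows that the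
  kernel is not everything and that the image is not zero, so irreducibility of the source gives
  injectivity and that of the target surjectivity.\<close>

lemma schur:
  assumes M: "irreducible_lie_module L M" and M': "irreducible_lie_module L M'"
    and \<psi>: "equivariant_map (carrier L) M M' \<psi>"
    and x: "x \<in> carrier M" "\<psi> x \<noteq> \<zero>\<^bsub>M'\<^esub>"
  shows "lie_module_isomorphic L M M'"
proof -
  have lM: "lie_module L M" and lM': "lie_module L M'"
    using M M' by (simp_all add: irreducible_lie_module_def)
  interpret M: lie_module L M by (rule lM)
  interpret M': lie_module L M' by (rule lM')
  have sM: "complex_space M" and sM': "complex_space M'"
    by (intro complex_space.intro M.M.module_axioms M'.M.module_axioms)+
  note lin = equivariant_mapD(1)[OF \<psi>]
  have zero: "act M' a \<zero>\<^bsub>M'\<^esub> = \<zero>\<^bsub>M'\<^esub>" if "a \<in> carrier L" for a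
    using linear_map_zero[OF sM' sM', of "act M' a"] that M'.act_closed M'.act_add_right M'.act_smult_right
    by (simp add: linear_map_def)
  have irr: "W = {\<zero>\<^bsub>M\<^esub>} \<or> W = carrier M"
    if "submodule W complex_ring M" "\<And>a w. a \<in> carrier L \<Longrightarrow> w \<in> W \<Longrightarrow> act M a w \<in> W" for W
    using M that unfolding irreducible_lie_module_def by blast
  have irr': "W = {\<zero>\<^bsub>M'\<^esub>} \<or> W = carrier M'"
    if "submodule W complex_ring M'" "\<And>a w. a \<in> carrier L \<Longrightarrow> w \<in> W \<Longrightarrow> act M' a w \<in> W" for W
    using M' that unfolding irreducible_lie_module_def by blast
  have "{u \<in> carrier M. \<psi> u = \<zero>\<^bsub>M'\<^esub>} = {\<zero>\<^bsub>M\<^esub>}"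
    using irr[OF linear_map_kernel[OF sM sM' lin]] x M.act_closed zero equivariant_mapD(2)[OF \<psi>]
    by fastforce
  then have "inj_on \<psi> (carrier M)"
    by (intro linear_map_inj_on[OF sM sM' lin]) blast
  moreover have "\<psi> ` carrier M = carrier M'"
  proof -
    have "act M' a w \<in> \<psi> ` carrier M" if "a \<in> carrier L" "w \<in> \<psi> ` carrier M" for a w
      using that M.act_closed by (auto simp flip: equivariant_mapD(2)[OF \<psi>])
    then show ?thesis using irr'[OF linear_map_image[OF sM sM' lin]] x by blast
  qed
  ultimately show ?thesis
    using \<psi> unfolding lie_module_isomorphic_iff bij_betw_def by blast
qed

section \<open>Evaluation modules as operator modules\<close>

lemma lie_module_space: "lie_module L M \<Longrightarrow> complex_space M"
  by (simp add: lie_module_def complex_space_def)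

lemma lie_module_act_linear: "lie_module L M \<Longrightarrow> x \<in> carrier L \<Longrightarrow> linear_map M M (act M x)"
  unfolding linear_map_def
  by (simp add: lie_module.act_closed lie_module.act_add_right lie_module.act_smult_right)

lemma lie_module_act_linear_left:
  "lie_module L M \<Longrightarrow> u \<in> carrier M \<Longrightarrow> linear_map L M (\<lambda>x. act M x u)"
  unfolding linear_map_def
  by (simp add: lie_module.act_closed lie_module.act_add_left lie_module.act_smult_left)

lemma eval_module_simps [simp]:
  "carrier (eval_module N rt L M z) = carrier M"
  "zero (eval_module N rt L M z) = zero M"
  "add (eval_module N rt L M z) = add M"
  "module.smult (eval_module N rt L M z) = module.smult M"
  by (simp_all add: eval_module_def)

lemma act_eval_module:
  "act (eval_module N rt L M z) x u = (\<Oplus>\<^bsub>M\<^esub>p\<in>{p. fst x p \<noteq> \<zero>\<^bsub>L\<^esub>}.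
     (z powi (p div int N) * rt z ^ nat (p mod int N)) \<odot>\<^bsub>M\<^esub> act M (fst x p) u)"
  by (cases x) (simp add: eval_module_def)

lemma eval_module_space:
  assumes "complex_space M"
  shows "complex_space (eval_module N rt L M z)"
proof -
  interpret M: complex_space M by fact
  show ?thesis
  proof (intro complex_space.intro moduleI abelian_groupI)
    show "cring complex_ring" by (rule M.R.is_cring)
    fix x assume "x \<in> carrier (eval_module N rt L M z)"
    then show "\<exists>y\<in>carrier (eval_module N rt L M z). y \<oplus>\<^bsub>eval_module N rt L M z\<^esub> x =
        \<zero>\<^bsub>eval_module N rt L M z\<^esub>"
      by (intro bexI[of _ "\<ominus>\<^bsub>M\<^esub> x"]) (simp_all add: M.M.l_neg)
  qed (simp_all add: M.scale_add_left M.scale_add_right M.scale_scale M.M.a_ac)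
qed

lemma linear_map_eval_module [simp]:
  "linear_map (eval_module N rt L M z) (eval_module N' rt' L' M' z') g \<longleftrightarrow> linear_map M M' g"
  by (simp add: linear_map_def)

lemma twisted_affineD:
  assumes "x \<in> carrier (twisted_affine L B \<sigma> N)"
  shows "finite {p. fst x p \<noteq> \<zero>\<^bsub>L\<^esub>}" "fst x p \<in> carrier L"
  using assms by (auto simp: twisted_affine_def graded_part_def)

lemma linear_map_act_eval_module:
  assumes M: "lie_module L M" and x: "x \<in> carrier (twisted_affine L B \<sigma> N)"
  shows "linear_map M M (act (eval_module N rt L M z) x)"
proof -
  note x = twisted_affineD[OF x]
  interpret M: complex_space M using M by (rule lie_module_space)
  have "linear_map M M (\<lambda>u. (z powi (p div int N) * rt z ^ nat (p mod int N)) \<odot>\<^bsub>M\<^esub> act M (fst x p) u)" for p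
    using linear_mapD[OF lie_module_act_linear[OF M x(2)]]
    by (simp add: linear_map_def M.scale_add_right M.scale_scale mult.commute)
  then show ?thesis
    unfolding act_eval_module by (intro linear_map_sum M.complex_space_axioms x(1))
qed

lemma tensor_product_eval_module:
  assumes "finite I" "\<And>i. i \<in> I \<Longrightarrow> lie_module L (U i)"
  shows "tensor_product I (\<lambda>i. eval_module N rt L (U i) (z i)) (carrier (twisted_affine L B \<sigma> N))"
  using assms
  by (intro tensor_product.intro)
    (auto intro: eval_module_space lie_module_space linear_map_act_eval_module)

text \<open>The action on an evaluation module is a finite combination of actions of
  \<open>L\<close> whose scalars depend on the point and the exponents but not on the module, so the
  given isomorphism serves unchanged.\<close>

lemma eval_module_isomorphic:
  assumes M: "lie_module L M" and M': "lie_module L M'" and iso: "lie_module_isomorphic L M M'"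
  shows "lie_module_isomorphic (twisted_affine L B \<sigma> N)
    (eval_module N rt L M z) (eval_module N rt L M' z)"
proof -
  note sM = lie_module_space[OF M] and sM' = lie_module_space[OF M']
  interpret M: complex_space M by (rule sM)
  interpret M': complex_space M' by (rule sM')
  obtain \<phi> where \<phi>: "equivariant_map (carrier L) M M' \<phi> \<and> bij_betw \<phi> (carrier M) (carrier M')"
    using iso unfolding lie_module_isomorphic_iff ..
  then have lin: "linear_map M M' \<phi>" by (simp add: equivariant_map_def)
  have "\<phi> (act (eval_module N rt L M z) x u) = act (eval_module N rt L M' z) x (\<phi> u)"
    if x: "x \<in> carrier (twisted_affine L B \<sigma> N)" and u: "u \<in> carrier M" for x u
  proof -
    note x = twisted_affineD[OF x]
    have fu: "act M (fst x p) u \<in> carrier M" for p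
      using linear_mapD(1)[OF lie_module_act_linear[OF M x(2)] u] .
    have "\<phi> (act (eval_module N rt L M z) x u) = (\<Oplus>\<^bsub>M'\<^esub>p\<in>{p. fst x p \<noteq> \<zero>\<^bsub>L\<^esub>}.
        \<phi> ((z powi (p div int N) * rt z ^ nat (p mod int N)) \<odot>\<^bsub>M\<^esub> act M (fst x p) u))"
      unfolding act_eval_module using fu by (intro linear_map_finsum[OF sM sM' lin x(1)]) auto
    also have "\<dots> = act (eval_module N rt L M' z) x (\<phi> u)"
      unfolding act_eval_module
      using linear_mapD(3)[OF lin fu] \<phi> x(2) u
        linear_mapD(1)[OF lie_module_act_linear[OF M' x(2)] linear_mapD(1)[OF lin u]]
      by (simp add: equivariant_map_def)
    finally show ?thesis .
  qed
  then have "equivariant_map (carrier (twisted_affine L B \<sigma> N))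
      (eval_module N rt L M z) (eval_module N rt L M' z) \<phi>"
    using lin by (simp add: equivariant_map_def)
  then show ?thesis using \<phi> unfolding lie_module_isomorphic_iff by auto
qed

section \<open>Separating the evaluation points\<close>

locale graded_lie_algebra = lie_algebra L
  for L :: "'g lie_algebra" (structure) +
  fixes \<sigma> :: "'g \<Rightarrow> 'g" and N :: nat
  assumes automorphism: "lie_automorphism L \<sigma>" and order: "has_order L \<sigma> N"
begin

sublocale complex_space L
  by (rule complex_space.intro[OF module_axioms])

abbreviation "\<epsilon> \<equiv> exp (2 * of_real pi * \<i> / of_nat N) :: complex"

lemma N_pos: "N > 0"
  using order by (simp add: has_order_def)

lemma eps_power: "\<epsilon> ^ k = cis (2 * pi * real k / real N)"
  by (simp add: cis_conv_exp mult_ac flip: exp_of_nat_mult)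

lemma eps_power_N: "\<epsilon> ^ N = 1"
  using N_pos by (simp add: eps_power)

text \<open>\<epsilon> is a primitive root: its first \<open>N\<close> powers enumerate the
  \<open>N\<close>-th roots of unity without repetition.\<close>

lemma eps_power_neq_1: "\<epsilon> ^ k \<noteq> 1" if "0 < k" "k < N"
proof -
  have "inj_on (\<lambda>k. cis (2 * pi * real k / real N)) {..<N}"
    using bij_betw_roots_unity[OF N_pos] by (simp add: bij_betw_def)
  from inj_onD[OF this, of k 0] show ?thesis
    using that by (auto simp: eps_power)
qed

lemma linear_map_sigma: "linear_map L L \<sigma>"
  using automorphism by (auto simp: lie_automorphism_def linear_map_def bij_betw_def)

lemma sigma_power_closed: "a \<in> carrier L \<Longrightarrow> (\<sigma> ^^ k) a \<in> carrier L"
  using linear_mapD(1)[OF linear_map_sigma] by (induction k) auto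

lemma sigma_power_N: "a \<in> carrier L \<Longrightarrow> (\<sigma> ^^ N) a = a"
  using order by (simp add: has_order_def)

text \<open>The projection onto the \<epsilon>^i-eigenspace of \<sigma>, written as a discrete
  Fourier average over the powers of \<sigma>.\<close>

definition component :: "nat \<Rightarrow> 'g \<Rightarrow> 'g" where
  "component i a = (\<Oplus>k\<in>{..<N}. (inverse (\<epsilon> ^ (i * k)) / of_nat N) \<odot> (\<sigma> ^^ k) a)"

lemma component_closed: "a \<in> carrier L \<Longrightarrow> component i a \<in> carrier L"
  unfolding component_def by (intro M.finsum_closed) (simp add: sigma_power_closed)

text \<open>A sum over one full period does not change under a cyclic shift. The induction compares
  partial sums completed by the term missing at either end.\<close>

lemma finsum_shift:
  assumes "\<And>k. g k \<in> carrier L" "g n = g 0"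
  shows "(\<Oplus>k\<in>{..<n}. g (Suc k)) = (\<Oplus>k\<in>{..<n}. g k)"
proof -
  have *: "g 0 \<oplus> (\<Oplus>k\<in>{..<m}. g (Suc k)) = g m \<oplus> (\<Oplus>k\<in>{..<m}. g k)" for m
  proof (induction m)
    case (Suc m)
    have "g 0 \<oplus> (\<Oplus>k\<in>{..<Suc m}. g (Suc k)) = g (Suc m) \<oplus> (g 0 \<oplus> (\<Oplus>k\<in>{..<m}. g (Suc k)))"
      using assms(1) by (simp add: lessThan_Suc M.a_lcomm)
    then show ?case using Suc assms(1) by (simp add: lessThan_Suc)
  qed (use assms in simp)
  show ?thesis using *[of n] assms by simp
qed

lemma component_graded:
  assumes a: "a \<in> carrier L"
  shows "component i a \<in> graded_part L \<sigma> N i"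
proof -
  \<comment> \<open>The terms of \<open>\<epsilon> ^ i \<odot> component i a\<close>. With this
    factor absorbed, \<sigma> maps the \<open>k\<close>-th term of the average to
    \<open>g (Suc k)\<close>, so \<sigma> acts as a cyclic shift.\<close>
  define g where "g k = (\<epsilon> ^ i * (inverse (\<epsilon> ^ (i * k)) / of_nat N)) \<odot> (\<sigma> ^^ k) a" for k
  have g: "g k \<in> carrier L" for k using a sigma_power_closed by (simp add: g_def)
  have "\<epsilon> ^ (i * N) = 1" by (simp add: mult.commute[of i] power_mult eps_power_N)
  then have gN: "g N = g 0" using a by (simp add: g_def sigma_power_N)
  have e: "(inverse (\<epsilon> ^ (i * k)) / of_nat N) \<odot> \<sigma> ((\<sigma> ^^ k) a) = g (Suc k)" for k
  proof -
    have "\<epsilon> ^ i * (inverse (\<epsilon> ^ (i * Suc k)) / of_nat N) = inverse (\<epsilon> ^ (i * k)) / of_nat N"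
      by (simp add: power_add field_simps)
    then show ?thesis by (simp only: g_def funpow.simps o_apply)
  qed
  have "\<sigma> (component i a) = (\<Oplus>k\<in>{..<N}. \<sigma> ((inverse (\<epsilon> ^ (i * k)) / of_nat N) \<odot> (\<sigma> ^^ k) a))"
    unfolding component_def using a sigma_power_closed
    by (intro linear_map_finsum[OF complex_space_axioms complex_space_axioms linear_map_sigma]) auto
  also have "\<dots> = (\<Oplus>k\<in>{..<N}. g (Suc k))"
    using linear_mapD(3)[OF linear_map_sigma sigma_power_closed[OF a]] by (simp only: e)
  also have "\<dots> = (\<Oplus>k\<in>{..<N}. g k)" by (rule finsum_shift[OF g gN])
  also have "\<dots> = \<epsilon> ^ i \<odot> component i a"
    unfolding component_def g_def using a sigma_power_closed
    by (subst finsum_scale_right) (auto simp: scale_scale)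
  finally show ?thesis using component_closed[OF a] by (simp add: graded_part_def)
qed

text \<open>Orthogonality of characters: after exchanging the sums, the coefficient of
  \<open>(\<sigma> ^^ k) a\<close> is a geometric sum over the \<open>N\<close>-th roots of unity,
  which vanishes unless \<open>k = 0\<close>.\<close>

lemma finsum_component:
  assumes a: "a \<in> carrier L"
  shows "(\<Oplus>i\<in>{..<N}. component i a) = a"
proof -
  have s: "(\<Sum>i<N. inverse (\<epsilon> ^ (i * k)) / of_nat N) = (if k = 0 then 1 else 0)" if "k < N" for k
  proof (cases "k = 0")
    case True
    then show ?thesis using N_pos by simp
  next
    case False
    define q where "q = inverse (\<epsilon> ^ k)"
    have "q \<noteq> 1" using eps_power_neq_1[of k] False that by (simp add: q_def)
    moreover have "q ^ N = 1"
      by (simp add: q_def power_inverse power_mult[symmetric] mult.commute[of k] power_mult eps_power_N)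
    ultimately have "(\<Sum>i<N. q ^ i) = 0" by (simp add: geometric_sum)
    moreover have "inverse (\<epsilon> ^ (i * k)) = q ^ i" for i
      by (simp add: q_def power_inverse power_mult[symmetric] mult.commute)
    ultimately show ?thesis using False by (simp flip: sum_divide_distrib)
  qed
  have "(\<Oplus>i\<in>{..<N}. component i a) =
      (\<Oplus>k\<in>{..<N}. \<Oplus>i\<in>{..<N}. (inverse (\<epsilon> ^ (i * k)) / of_nat N) \<odot> (\<sigma> ^^ k) a)"
    unfolding component_def using a sigma_power_closed by (intro finsum_swap) auto
  also have "\<dots> = (\<Oplus>k\<in>{..<N}. if 0 = k then (\<sigma> ^^ k) a else \<zero>)"
  proof (rule M.finsum_cong'[OF refl])
    fix k assume k: "k \<in> {..<N}"
    have "(\<Oplus>i\<in>{..<N}. (inverse (\<epsilon> ^ (i * k)) / of_nat N) \<odot> (\<sigma> ^^ k) a) =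
        (\<Sum>i<N. inverse (\<epsilon> ^ (i * k)) / of_nat N) \<odot> (\<sigma> ^^ k) a"
      using a sigma_power_closed by (intro finsum_scale_left[symmetric]) auto
    then show "(\<Oplus>i\<in>{..<N}. (inverse (\<epsilon> ^ (i * k)) / of_nat N) \<odot> (\<sigma> ^^ k) a) =
        (if 0 = k then (\<sigma> ^^ k) a else \<zero>)"
      using s k a sigma_power_closed[OF a] by auto
  qed (use a sigma_power_closed in auto)
  also have "\<dots> = a"
    using N_pos a sigma_power_closed M.add.finprod_singleton[of 0 "{..<N}" "\<lambda>k. (\<sigma> ^^ k) a"] by simp
  finally show ?thesis .
qed

text \<open>The sum of \<open>\<rho>\<^sup>-\<^sup>i a\<^sub>i \<otimes> t powr (i/N) p(t)\<close> over \<open>0 \<le> i < N\<close>, where \<open>a = \<Sum>\<^sub>i a\<^sub>i\<close> is the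
  decomposition of \<open>a\<close> along the grading and \<open>p(t) = \<Sum>\<^sub>n\<^sub><\<^sub>D c\<^sub>n t\<^sup>n\<close>. The number \<open>\<rho>\<close> will be the chosen
  \<open>N\<close>-th root of the point where \<open>p\<close> takes the value 1.\<close>

definition loop_element :: "(nat \<Rightarrow> complex) \<Rightarrow> nat \<Rightarrow> complex \<Rightarrow> 'g \<Rightarrow> (int \<Rightarrow> 'g) \<times> complex" where
  "loop_element c D \<rho> a =
     (\<lambda>p. if p \<in> int ` {..<N * D}
          then (c (nat p div N) / \<rho> ^ (nat p mod N)) \<odot> component (nat p mod N) a else \<zero>, 0)"

lemma loop_element_closed:
  assumes a: "a \<in> carrier L"
  shows "loop_element c D \<rho> a \<in> carrier (twisted_affine L B \<sigma> N)"
proof -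
  have g: "b \<odot> x \<in> graded_part L \<sigma> N i" if "x \<in> graded_part L \<sigma> N i" for b x i
    using that linear_mapD(3)[OF linear_map_sigma]
    by (auto simp: graded_part_def scale_scale mult.commute)
  have z: "\<zero> \<in> graded_part L \<sigma> N i" for i
    using linear_map_zero[OF complex_space_axioms complex_space_axioms linear_map_sigma]
    by (simp add: graded_part_def)
  have "finite {p. fst (loop_element c D \<rho> a) p \<noteq> \<zero>}"
    by (rule finite_subset[of _ "int ` {..<N * D}"]) (auto simp: loop_element_def)
  moreover have "fst (loop_element c D \<rho> a) p \<in> graded_part L \<sigma> N (nat (p mod int N))" for p
    using g[OF component_graded[OF a]] z by (auto simp: loop_element_def nat_mod_distrib)
  ultimately show ?thesis by (simp add: twisted_affine_def loop_element_def)
qed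

text \<open>The exponent p = n N + i contributes c_n z^n (\<open>rt z\<close> / \<rho>)^i times the
  action of the \<open>i\<close>-th component, so summing over n first produces the value of the
  polynomial at \<open>z\<close>. Only nonnegative exponents occur, which makes \<open>powi\<close>
  an ordinary power.\<close>

lemma act_loop_element:
  assumes M: "lie_module L M" and a: "a \<in> carrier L" and u: "u \<in> carrier M"
  shows "act (eval_module N rt L M z) (loop_element c D \<rho> a) u =
    (\<Oplus>\<^bsub>M\<^esub>i\<in>{..<N}. ((\<Sum>n<D. c n * z ^ n) * (rt z / \<rho>) ^ i) \<odot>\<^bsub>M\<^esub> act M (component i a) u)"
proof -
  interpret M': complex_space M using M by (rule lie_module_space)
  define f where "f = fst (loop_element c D \<rho> a)"
  define v where "v i = act M (component i a) u" for i
  have v: "v i \<in> carrier M" for i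
    unfolding v_def by (rule linear_mapD(1)[OF lie_module_act_linear[OF M component_closed[OF a]] u])
  define G where "G n i = (c n * z ^ n * (rt z / \<rho>) ^ i) \<odot>\<^bsub>M\<^esub> v i" for n i
  have G: "G n i \<in> carrier M" for n i using v by (simp add: G_def)
  note lu = lie_module_act_linear_left[OF M u]
  have zero: "act M \<zero> u = \<zero>\<^bsub>M\<^esub>"
    by (rule linear_map_zero[OF complex_space_axioms M'.complex_space_axioms lu])
  let ?h = "\<lambda>p. (z powi (p div int N) * rt z ^ nat (p mod int N)) \<odot>\<^bsub>M\<^esub> act M (f p) u"
  have h: "?h (int p) = G (p div N) (p mod N)" if "p < N * D" for p
  proof -
    have "f (int p) = (c (p div N) / \<rho> ^ (p mod N)) \<odot> component (p mod N) a"
      using that by (simp add: f_def loop_element_def)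
    moreover have "int p div int N = int (p div N)" "nat (int p mod int N) = p mod N"
      by (simp_all add: zdiv_int nat_mod_distrib)
    ultimately show ?thesis
      using linear_mapD(3)[OF lu component_closed[OF a]] v
      by (simp add: G_def v_def M'.scale_scale power_divide mult_ac)
  qed
  have supp: "{p. f p \<noteq> \<zero>} \<subseteq> int ` {..<N * D}"
    by (auto simp: f_def loop_element_def)
  have "act (eval_module N rt L M z) (loop_element c D \<rho> a) u = finsum M ?h {p. f p \<noteq> \<zero>}"
    by (simp add: f_def act_eval_module)
  \<comment> \<open>Some coefficients inside the block may vanish, so the support can be smaller;
    the missing terms are zero because \<open>\<zero>\<close> acts as zero.\<close>
  also have "\<dots> = finsum M ?h (int ` {..<N * D})"
  proof (rule M'.finsum_mono_neutral[OF _ supp])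
    show "?h p = \<zero>\<^bsub>M\<^esub>" if "p \<in> int ` {..<N * D} - {p. f p \<noteq> \<zero>}" for p
      using that zero by simp
    show "?h \<in> {p. f p \<noteq> \<zero>} \<rightarrow> carrier M"
    proof
      fix p assume "p \<in> {p. f p \<noteq> \<zero>}"
      then obtain q where "p = int q" "q < N * D" using supp by auto
      then show "?h p \<in> carrier M" using h[of q] G by simp
    qed
  qed simp
  also have "\<dots> = (\<Oplus>\<^bsub>M\<^esub>p\<in>{..<N * D}. ?h (int p))"
    using h G by (intro M'.M.finsum_reindex Pi_I) (auto simp del: of_nat_mult)
  also have "\<dots> = (\<Oplus>\<^bsub>M\<^esub>p\<in>{..<N * D}. G (p div N) (p mod N))"
    using h G by (intro M'.M.finsum_cong') auto
  also have "\<dots> = (\<Oplus>\<^bsub>M\<^esub>i\<in>{..<N}. \<Oplus>\<^bsub>M\<^esub>n\<in>{..<D}. G n i)"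
    using G N_pos by (rule M'.finsum_div_mod)
  also have "\<dots> = (\<Oplus>\<^bsub>M\<^esub>i\<in>{..<N}. ((\<Sum>n<D. c n * z ^ n) * (rt z / \<rho>) ^ i) \<odot>\<^bsub>M\<^esub> v i)"
    using v unfolding G_def
    by (intro M'.M.finsum_cong') (auto simp: M'.finsum_scale_left[symmetric] sum_distrib_right)
  finally show ?thesis by (simp add: v_def)
qed

text \<open>The polynomial value is a common factor of all residues, so its vanishing disposes of
  every component, whatever the ratio of the roots.\<close>

lemma act_loop_element_zero:
  assumes M: "lie_module L M" and a: "a \<in> carrier L" and u: "u \<in> carrier M"
    and "(\<Sum>n<D. c n * z ^ n) = 0"
  shows "act (eval_module N rt L M z) (loop_element c D \<rho> a) u = \<zero>\<^bsub>M\<^esub>"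
proof -
  interpret M': complex_space M using M by (rule lie_module_space)
  show ?thesis
    unfolding act_loop_element[OF M a u] assms(4)
    using linear_mapD(1)[OF lie_module_act_linear[OF M component_closed[OF a]] u]
    by (intro M'.M.add.finprod_one_eqI) simp
qed

text \<open>With \<open>rt z\<close> itself as the normalizing number the ratio of roots is 1, and
  the components recombine to \<open>a\<close>.\<close>

lemma act_loop_element_self:
  assumes M: "lie_module L M" and a: "a \<in> carrier L" and u: "u \<in> carrier M"
    and "(\<Sum>n<D. c n * z ^ n) = 1" "rt z \<noteq> 0"
  shows "act (eval_module N rt L M z) (loop_element c D (rt z) a) u = act M a u"
proof -
  interpret M': complex_space M using M by (rule lie_module_space)
  have v: "act M (component i a) u \<in> carrier M" for i
    by (rule linear_mapD(1)[OF lie_module_act_linear[OF M component_closed[OF a]] u])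
  have "act (eval_module N rt L M z) (loop_element c D (rt z) a) u =
      (\<Oplus>\<^bsub>M\<^esub>i\<in>{..<N}. act M (component i a) u)"
    unfolding act_loop_element[OF M a u] using assms(4,5) v by (simp cong: M'.M.finsum_cong)
  also have "\<dots> = act M (\<Oplus>i\<in>{..<N}. component i a) u"
    using component_closed[OF a]
    by (intro linear_map_finsum[OF complex_space_axioms M'.complex_space_axioms
          lie_module_act_linear_left[OF M u], symmetric]) auto
  finally show ?thesis using finsum_component[OF a] by simp
qed

end

text \<open>The product of the linear factors at the points of \<open>S\<close>, divided by its
  value at \<open>w\<close>; that value is nonzero because \<open>w\<close> is not in
  \<open>S\<close>.\<close>

lemma interpolation_coefficients:
  fixes w :: complex
  assumes "finite S" "w \<notin> S"
  shows "\<exists>c D. (\<Sum>n<D. c n * w ^ n) = 1 \<and> (\<forall>x\<in>S. (\<Sum>n<D. c n * x ^ n) = 0)"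
proof -
  define p where "p = smult (inverse (\<Prod>x\<in>S. w - x)) (\<Prod>x\<in>S. [:- x, 1:])"
  have p: "poly p y = inverse (\<Prod>x\<in>S. w - x) * (\<Prod>x\<in>S. y - x)" for y
    by (simp add: p_def poly_prod)
  have e: "poly p y = (\<Sum>n<Suc (degree p). coeff p n * y ^ n)" for y
    by (simp only: poly_altdef lessThan_Suc_atMost)
  have "(\<Prod>x\<in>S. w - x) \<noteq> 0" using assms by (auto simp: prod_zero_iff)
  then have "poly p w = 1" unfolding p by simp
  moreover have "poly p x = 0" if "x \<in> S" for x
    using assms(1) that unfolding p by (auto simp: prod_zero_iff)
  ultimately show ?thesis unfolding e by blast
qed

lemma tensor_module_isomorphic_sym:
  assumes "tensor_product I M (carrier L)" "lie_module_isomorphic L (tensor_module I M) M'"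
  shows "lie_module_isomorphic L M' (tensor_module I M)"
proof -
  interpret tensor_product I M "carrier L" by fact
  show ?thesis
    by (rule lie_module_isomorphic_sym[OF assms(2) T.complex_space_axioms
          linear_mapD(1)[OF linear_map_act_tensor]])
qed

context graded_lie_algebra
begin

text \<open>Deliberately one-sided, from a factor on the right to its partner on the left, and with
  separate types for the two families: the theorem applies it to an isomorphism and to its
  inverse.\<close>

lemma isomorphic_factor:
  fixes U :: "'i \<Rightarrow> ('g, 'u) lie_module" and V :: "'j \<Rightarrow> ('g, 'v) lie_module"
  assumes rt: "\<And>w. w \<noteq> 0 \<Longrightarrow> rt w ^ N = w"
    and I: "finite I" "\<And>i. i \<in> I \<Longrightarrow> irreducible_lie_module L (U i)" "inj_on z I"
    and J: "finite J" "\<And>j. j \<in> J \<Longrightarrow> irreducible_lie_module L (V j)" "inj_on \<xi> J"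
    and k: "k \<in> J" "nontrivial_lie_module L (V k)" "\<xi> k \<noteq> 0"
    and iso: "lie_module_isomorphic (twisted_affine L B \<sigma> N)
      (tensor_module I (\<lambda>i. eval_module N rt L (U i) (z i)))
      (tensor_module J (\<lambda>j. eval_module N rt L (V j) (\<xi> j)))"
  shows "\<exists>i\<in>I. z i = \<xi> k \<and> lie_module_isomorphic L (U i) (V k)"
proof -
  let ?A = "carrier (twisted_affine L B \<sigma> N)"
  let ?U = "\<lambda>i. eval_module N rt L (U i) (z i)" and ?V = "\<lambda>j. eval_module N rt L (V j) (\<xi> j)"
  define w where "w = \<xi> k"
  have U: "lie_module L (U i)" if "i \<in> I" for i
    using I(2)[OF that] by (simp add: irreducible_lie_module_def)
  have V: "lie_module L (V j)" "carrier (V j) \<noteq> {\<zero>\<^bsub>V j\<^esub>}" if "j \<in> J" for j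
    using J(2)[OF that] by (simp_all add: irreducible_lie_module_def)
  \<comment> \<open>Its powers are the denominators in \<open>loop_element\<close>.\<close>
  have "rt w \<noteq> 0" using rt[of w] k(3) N_pos by (auto simp: w_def zero_power)
  \<comment> \<open>The same polynomial must vanish at the remaining points of both families: on the
    right to isolate the factor \<open>k\<close>, on the left to silence every factor not at
    \<open>w\<close>.\<close>
  obtain c D where c: "(\<Sum>n<D. c n * w ^ n) = 1" "\<forall>x\<in>(z ` I \<union> \<xi> ` J) - {w}. (\<Sum>n<D. c n * x ^ n) = 0"
    using interpolation_coefficients[of "(z ` I \<union> \<xi> ` J) - {w}" w] I(1) J(1) by auto
  define e where "e = loop_element c D (rt w)"
  have e_U: "act (?U i) (e a) u = (if z i = w then act (U i) a u else \<zero>\<^bsub>U i\<^esub>)"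
    if "i \<in> I" "a \<in> carrier L" "u \<in> carrier (U i)" for i a u
    using act_loop_element_self[where rt = rt, OF U[OF that(1)] that(2,3)] c(1) \<open>rt w \<noteq> 0\<close>
      act_loop_element_zero[OF U[OF that(1)] that(2,3)] c(2) that(1) by (auto simp: e_def)
  have e_V: "act (?V j) (e a) v = (if \<xi> j = w then act (V j) a v else \<zero>\<^bsub>V j\<^esub>)"
    if "j \<in> J" "a \<in> carrier L" "v \<in> carrier (V j)" for j a v
    using act_loop_element_self[where rt = rt, OF V(1)[OF that(1)] that(2,3)] c(1) \<open>rt w \<noteq> 0\<close>
      act_loop_element_zero[OF V(1)[OF that(1)] that(2,3)] c(2) that(1) by (auto simp: e_def)
  obtain \<phi> where \<phi>: "equivariant_map ?A (tensor_module I ?U) (tensor_module J ?V) \<phi> \<and>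
      bij_betw \<phi> (carrier (tensor_module I ?U)) (carrier (tensor_module J ?V))"
    using iso unfolding lie_module_isomorphic_iff ..
  obtain a0 v0 where nt: "a0 \<in> carrier L" "v0 \<in> carrier (V k)" "act (V k) a0 v0 \<noteq> \<zero>\<^bsub>V k\<^esub>"
    using k(2) by (auto simp: nontrivial_lie_module_def)
  have "\<exists>i\<in>{i \<in> I. z i = w}. \<exists>\<psi>. equivariant_map (e ` carrier L) (?U i) (?V k) \<psi> \<and>
      (\<exists>x\<in>carrier (?U i). \<psi> x \<noteq> \<zero>\<^bsub>?V k\<^esub>)"
  proof (rule surjection_factor[where k = k and M = ?U and M' = ?V and E = "e ` carrier L" and A = ?A])
    show "tensor_product I ?U ?A" by (rule tensor_product_eval_module[OF I(1) U])
    show "tensor_product J ?V ?A" by (rule tensor_product_eval_module[OF J(1) V(1)])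
    show "equivariant_map ?A (tensor_module I ?U) (tensor_module J ?V) \<phi>" using \<phi> ..
    show "\<phi> ` carrier (tensor_module I ?U) = carrier (tensor_module J ?V)"
      using \<phi> by (simp add: bij_betw_def)
    show "e ` carrier L \<subseteq> ?A" using loop_element_closed by (auto simp: e_def)
    show "act (?V j) a v = \<zero>\<^bsub>?V j\<^esub>"
      if "a \<in> e ` carrier L" "j \<in> J" "j \<noteq> k" "v \<in> carrier (?V j)" for a j v
      using that e_V inj_onD[OF J(3)] k(1) by (auto simp: w_def)
    show "act (?U i) a v = \<zero>\<^bsub>?U i\<^esub>"
      if "a \<in> e ` carrier L" "i \<in> I" "i \<notin> {i \<in> I. z i = w}" "v \<in> carrier (?U i)" for a i v
      using that e_U by auto
    show "i = i'" if "i \<in> {i \<in> I. z i = w}" "i' \<in> {i \<in> I. z i = w}" for i i'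
      using that inj_onD[OF I(3)] by auto
    show "e a0 \<in> e ` carrier L" "v0 \<in> carrier (?V k)" using nt by auto
    show "act (?V k) (e a0) v0 \<noteq> \<zero>\<^bsub>?V k\<^esub>" using e_V[OF k(1)] nt by (simp add: w_def)
  qed (use k(1) V(2) in auto)
  then obtain i \<psi> x where i: "i \<in> I" "z i = w" and x: "x \<in> carrier (U i)" "\<psi> x \<noteq> \<zero>\<^bsub>V k\<^esub>"
    and \<psi>: "equivariant_map (e ` carrier L) (?U i) (?V k) \<psi>"
    by auto
  \<comment> \<open>At the point \<open>w\<close> the element \<open>e a\<close> acts as
    \<open>a\<close> on both sides, so commuting with all \<open>e a\<close> is the same as
    commuting with \<open>L\<close>.\<close>
  have \<psi>': "equivariant_map (carrier L) (U i) (V k) \<psi>"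
    using \<psi> e_U[OF i(1)] e_V[OF k(1)] i(2) linear_mapD(1)[OF equivariant_mapD(1)[OF \<psi>]]
    by (simp add: equivariant_map_def w_def)
  have "lie_module_isomorphic L (U i) (V k)"
    by (rule schur[OF I(2)[OF i(1)] J(2)[OF k(1)] \<psi>' x])
  then show ?thesis using i by (auto simp: w_def)
qed

end

theorem proposition3p5:
  fixes L :: "'g lie_algebra"
    and B :: "'g \<Rightarrow> 'g \<Rightarrow> complex"
    and \<sigma> :: "'g \<Rightarrow> 'g"
    and N :: nat
    and rt :: "complex \<Rightarrow> complex"
    and r s :: nat
    and U :: "nat \<Rightarrow> ('g, 'u) lie_module"
    and V :: "nat \<Rightarrow> ('g, 'v) lie_module"
    and z \<xi> :: "nat \<Rightarrow> complex"
  assumes "simple_lie_algebra L" and "finite_dimensional L"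
    and "normalized_invariant_form L B"
    and "lie_automorphism L \<sigma>" and "has_order L \<sigma> N"
    and "\<And>w. w \<noteq> 0 \<Longrightarrow> rt w ^ N = w"
    and "\<And>j. j \<in> {1..r} \<Longrightarrow> irreducible_lie_module L (U j)"
    and "\<And>j. j \<in> {1..r} \<Longrightarrow> nontrivial_lie_module L (U j)"
    and "\<And>j. j \<in> {1..s} \<Longrightarrow> irreducible_lie_module L (V j)"
    and "\<And>j. j \<in> {1..s} \<Longrightarrow> nontrivial_lie_module L (V j)"
    and "\<And>j. j \<in> {1..r} \<Longrightarrow> z j \<noteq> 0" and "inj_on z {1..r}"
    and "\<And>j. j \<in> {1..s} \<Longrightarrow> \<xi> j \<noteq> 0" and "inj_on \<xi> {1..s}"
  shows "lie_module_isomorphic (twisted_affine L B \<sigma> N)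
           (tensor_module {1..r} (\<lambda>j. eval_module N rt L (U j) (z j)))
           (tensor_module {1..s} (\<lambda>j. eval_module N rt L (V j) (\<xi> j)))
         \<longleftrightarrow> r = s \<and>
             (\<exists>\<pi>. \<pi> permutes {1..r} \<and>
               (\<forall>j\<in>{1..r}. z j = \<xi> (\<pi> j) \<and> lie_module_isomorphic L (U j) (V (\<pi> j))))"
    (is "?iso \<longleftrightarrow> ?rhs")
proof -
  interpret graded_lie_algebra L \<sigma> N
    using assms(1,4,5)
    by (simp add: simple_lie_algebra_def graded_lie_algebra_def graded_lie_algebra_axioms_def)
  have U: "lie_module L (U j)" if "j \<in> {1..r}" for j
    using assms(7)[OF that] by (simp add: irreducible_lie_module_def)
  have V: "lie_module L (V j)" if "j \<in> {1..s}" for j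
    using assms(9)[OF that] by (simp add: irreducible_lie_module_def)
  have TU: "tensor_product {1..r} (\<lambda>j. eval_module N rt L (U j) (z j))
      (carrier (twisted_affine L B \<sigma> N))"
    by (rule tensor_product_eval_module[OF _ U]) simp_all
  have TV: "tensor_product {1..s} (\<lambda>j. eval_module N rt L (V j) (\<xi> j))
      (carrier (twisted_affine L B \<sigma> N))"
    by (rule tensor_product_eval_module[OF _ V]) simp_all
  show ?thesis
  proof
    assume iso: ?iso
    have VU: "\<exists>i\<in>{1..r}. z i = \<xi> k \<and> lie_module_isomorphic L (U i) (V k)" if k: "k \<in> {1..s}" for k
      by (rule isomorphic_factor[OF assms(6) _ assms(7,12) _ assms(9,14) k assms(10)[OF k]
            assms(13)[OF k] iso]) simp_all
    \<comment> \<open>The inverse isomorphism gives the other inclusion between the sets of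
      points.\<close>
    have UV: "\<exists>k\<in>{1..s}. \<xi> k = z i \<and> lie_module_isomorphic L (V k) (U i)" if i: "i \<in> {1..r}" for i
      by (rule isomorphic_factor[OF assms(6) _ assms(9,14) _ assms(7,12) i assms(8)[OF i]
            assms(11)[OF i] tensor_module_isomorphic_sym[OF TU iso]]) simp_all
    have "z ` {1..r} = \<xi> ` {1..s}"
    proof (intro equalityI image_subsetI)
      show "z i \<in> \<xi> ` {1..s}" if "i \<in> {1..r}" for i using UV[OF that] by (metis image_eqI)
      show "\<xi> k \<in> z ` {1..r}" if "k \<in> {1..s}" for k using VU[OF that] by (metis image_eqI)
    qed
    then have rs: "r = s"
      using card_image[OF assms(12)] card_image[OF assms(14)] by simp
    \<comment> \<open>The index on the right with the same point; outside the range it is the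
      identity, as \<open>permutes\<close> demands.\<close>
    define \<pi> where "\<pi> j = (if j \<in> {1..r} then SOME k. k \<in> {1..r} \<and> \<xi> k = z j else j)" for j
    have \<pi>: "\<pi> j \<in> {1..r}" "\<xi> (\<pi> j) = z j" if "j \<in> {1..r}" for j
    proof -
      have "\<exists>k. k \<in> {1..r} \<and> \<xi> k = z j" using UV[OF that] rs by auto
      from someI_ex[OF this] show "\<pi> j \<in> {1..r}" "\<xi> (\<pi> j) = z j" using that by (simp_all add: \<pi>_def)
    qed
    have "inj_on \<pi> {1..r}"
      using \<pi>(2) inj_onD[OF assms(12)] by (intro inj_onI) metis
    moreover have "\<pi> ` {1..r} \<subseteq> {1..r}" using \<pi>(1) by blast
    ultimately have "bij_betw \<pi> {1..r} {1..r}"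
      by (simp add: bij_betw_def endo_inj_surj)
    then have "\<pi> permutes {1..r}"
      by (rule bij_imp_permutes) (auto simp: \<pi>_def)
    moreover have "lie_module_isomorphic L (U j) (V (\<pi> j))" if j: "j \<in> {1..r}" for j
    proof -
      obtain i where i: "i \<in> {1..r}" "z i = \<xi> (\<pi> j)" "lie_module_isomorphic L (U i) (V (\<pi> j))"
        using VU[of "\<pi> j"] \<pi>(1)[OF j] rs by blast
      \<comment> \<open>\<open>VU\<close> yields a partner of \<open>V (\<pi> j)\<close> with the
        same point, and distinctness of the points on the left identifies it with
        \<open>U j\<close>.\<close>
      then have "i = j" using \<pi>(2)[OF j] inj_onD[OF assms(12) _ i(1) j] by simp
      then show ?thesis using i(3) by simp
    qed
    ultimately show ?rhs using rs \<pi>(2) by (intro conjI exI[of _ \<pi>]) auto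
  next
    assume ?rhs
    then obtain \<pi> where rs: "r = s" and \<pi>: "\<pi> permutes {1..r}"
      and j: "\<And>j. j \<in> {1..r} \<Longrightarrow> z j = \<xi> (\<pi> j)"
        "\<And>j. j \<in> {1..r} \<Longrightarrow> lie_module_isomorphic L (U j) (V (\<pi> j))"
      by blast
    have \<pi>s: "\<pi> j \<in> {1..s}" if "j \<in> {1..r}" for j
      using permutes_in_image[OF \<pi>] that rs by simp
    show ?iso
    proof (rule tensor_isomorphic[OF TU TV])
      show "bij_betw \<pi> {1..r} {1..s}" using permutes_imp_bij[OF \<pi>] rs by simp
      show "lie_module_isomorphic (twisted_affine L B \<sigma> N) (eval_module N rt L (U i) (z i))
          (eval_module N rt L (V (\<pi> i)) (\<xi> (\<pi> i)))" if i: "i \<in> {1..r}" for i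
        using eval_module_isomorphic[OF U[OF i] V[OF \<pi>s[OF i]] j(2)[OF i]] by (simp add: j(1)[OF i])
    qed
  qed
qed

end
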